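(* Let $L=\Delta+q\Delta^{-1}r$ be the Lax operator of the constrained discrete KP (cdKP) hierarchy with $m=1$, $l=1$, with eigenfunction $q$ and adjoint eigenfunction $r$, and let $M_\Delta$ and $X^{(1)}_{k-1}$ be the associated Orlov–Schulman operator and pseudo-difference operator defined in the context. Let $\partial_k^*$ ($k\ge 2$) be the additional symmetry flow $$\partial_k^*L=\left[-(M_\Delta L^k)_-+X^{(1)}_{k-1},\,L\right],$$ whose corresponding actions on $q$ and $r$ are $$\partial_k^*q=(M_\Delta L^k)_+(q)+\tfrac k2L^{k-1}(q)+X^{(1)}_{k-1}(q),\qquad \partial_k^*r=-(M_\Delta L^k)_+^*(r)+\tfrac k2(L^* )^{k-1}(r)-(X^{(1)}_{k-1})^*(r).$$ Let $T=T_I(r)=\Lambda^{-1}(r^{-1})\Delta^{-1}r$ be the integral type gauge transformation operator, and put $$\widetilde L=TLT^{-1},\quad \widetilde M_\Delta=TM_\Delta T^{-1},\quad \widetilde q=\Lambda^{-1}(r^{-1}),\quad \widetilde r=T^{*-1}\big(L^*(r)\big),$$ $$\widetilde X^{(1)}_{k-1}=\sum_{j=0}^{k-2}\Big(j-\tfrac12(k-2)\Big)\widetilde L^{k-2-j}(\widetilde q)\,\Delta^{-1}(\widetilde L^* )^j(\widetilde r).$$ Then the additional symmetry flows commute with the integral type gauge transformation $T_I(r)$, which preserves the form of the cdKP hierarchy, up to shifting of the additional flows by ordinary time flows, that is, $$\partial_k^*\widetilde L=\left[-(\widetilde M_\Delta\widetilde L^k)_-+\widetilde X^{(1)}_{k-1},\,\widetilde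 L\right]-\frac{\partial\widetilde L}{\partial t_{k-1}}.$$
   Context: Functions $f=f(n)=f(n,t_1,t_2,\dots)$ depend on $n\in\mathbb Z$ and real times $t_i$. $\Lambda f(n)=f(n+1)$, $\Delta=\Lambda-I$. Pseudo-difference operators are formal series $\sum_{j\le d}f_j(n)\Delta^j$, multiplied by the rule $\Delta^jf=\sum_{i\ge0}\binom ji(\Delta^if)(n+j-i)\Delta^{j-i}$ for all $j\in\mathbb Z$; $A_+$ is the part of $A$ with non-negative powers of $\Delta$, and $A_-=A-A_+$. The adjoint satisfies $(AB)^*=B^*A^*$, $f^*=f$ for functions, $\Delta^*=\Lambda^{-1}-I$; $T^{*-1}$ means $(T^* )^{-1}$. $A(f)$ denotes the action of $A$ on the function $f$, while $Af$ or $A\cdot f$ is the operator product; $\Lambda^{\pm1}(f)$ is the shifted function. cdKP hierarchy ($m=1,l=1$): $L=\Delta+q\Delta^{-1}r$ with $\partial L/\partial t_k=[B_k,L]$, $B_k=(L^k)_+$, $k\ge1$; the eigenfunction $q$ and adjoint eigenfunction $r$ satisfy $\partial q/\partial t_k=B_k(q)$, $\partial r/\partial t_k=-B_k^*(r)$. The dressing operator $W=1+\sum_{j\ge1}w_j\Delta^{-j}$ satisfies $L=W\Delta W^{-1}$, $\partial W/\partial t_k=-(L^k)_-W$. The operator $T$ is a gauge transformation operator: $\partial\widetilde L/\partial t_j=[(\widetilde L^j)_+,\widetilde L]$ for all $j\ge1$; and $\widetilde L_-=\widetilde q\Delta^{-1}\widetilde r$. Orlov–Schulman operator: $M_\Delta=WM^{(0)}W^{-1}$,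 where $M^{(0)}=\sum_{l\ge1}l\,t_l\Delta^{l-k}=X_{(k)}+\sum_{l\ge1}(l+k)t_{l+k}\Delta^l$ with $X_{(k)}=\sum_{l=1}^{k}l\,t_l\Delta^{l-k}$. $X^{(1)}_{k-1}=\sum_{j=0}^{k-2}\big(j-\tfrac12(k-2)\big)L^{k-2-j}(q)\,\Delta^{-1}(L^* )^j(r)$. The action of $\Delta^{-1}$ on functions is a formal antidifference, with summation constants understood so that $\widetilde L^{i+1}(\widetilde q)=T(L^i(q))$ and $(\widetilde L^* )^{j}(\widetilde r)=T^{*-1}((L^* )^{j+1}(r))$ for $i,j\ge0$. *)

theory Defs
  imports "HOL-Analysis.Analysis" "HOL-Library.Function_Algebras" "HOL-Library.Poly_Mapping"
begin

section \<open>Functions of the discrete variable\<close>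

text \<open>At a fixed value of all times a function of \<open>n\<close> has type \<open>int \<Rightarrow> 'a\<close>; sums and products
  of functions are pointwise.\<close>

definition shift :: "int \<Rightarrow> (int \<Rightarrow> 'a) \<Rightarrow> int \<Rightarrow> 'a" where
  "shift k f = (\<lambda>n. f (n + k))"

definition diff :: "(int \<Rightarrow> 'a::ab_group_add) \<Rightarrow> int \<Rightarrow> 'a" where
  "diff f = (\<lambda>n. f (n + 1) - f n)"

definition diff_adj :: "(int \<Rightarrow> 'a::ab_group_add) \<Rightarrow> int \<Rightarrow> 'a" where
  "diff_adj f = (\<lambda>n. f (n - 1) - f n)"

definition recip :: "(int \<Rightarrow> 'a::inverse) \<Rightarrow> int \<Rightarrow> 'a" where
  "recip f = (\<lambda>n. inverse (f n))"

section \<open>Pseudo-difference operators\<close>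

text \<open>\<open>coeff A j\<close> is the function standing to the left of the \<open>j\<close>-th power of \<open>\<Delta>\<close> in \<open>A\<close>.\<close>

typedef (overloaded) 'a pdo = "{a :: int \<Rightarrow> int \<Rightarrow> 'a::zero. \<exists>d. \<forall>j>d. a j = 0}"
  morphisms coeff Abs_pdo
  by (rule exI[of _ 0]) simp

setup_lifting type_definition_pdo

instantiation pdo :: (ab_group_add) ab_group_add
begin

lift_definition zero_pdo :: "'a pdo" is 0
  by simp

lift_definition plus_pdo :: "'a pdo \<Rightarrow> 'a pdo \<Rightarrow> 'a pdo" is "\<lambda>a b j. a j + b j"
proof -
  fix a b :: "int \<Rightarrow> int \<Rightarrow> 'a"
  assume "\<exists>d. \<forall>j>d. a j = 0" "\<exists>d. \<forall>j>d. b j = 0"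
  then obtain d e where "\<forall>j>d. a j = 0" "\<forall>j>e. b j = 0" by blast
  then have "\<forall>j>max d e. a j + b j = 0" by simp
  then show "\<exists>d. \<forall>j>d. a j + b j = 0" by blast
qed

lift_definition uminus_pdo :: "'a pdo \<Rightarrow> 'a pdo" is "\<lambda>a j. - a j"
  by simp

definition minus_pdo :: "'a pdo \<Rightarrow> 'a pdo \<Rightarrow> 'a pdo" where
  "minus_pdo A B = A + - B"

instance
  by standard (unfold minus_pdo_def, (transfer, simp add: fun_eq_iff algebra_simps)+)

end

text \<open>The product extends \<open>\<Delta>\<^sup>j f = (\<Sum>i\<ge>0. (j choose i) (\<Delta>\<^sup>i f)(n + j - i) \<Delta>\<^bsup>j-i\<^esup>)\<close>: the
  coefficient at power \<open>m\<close> collects the terms with \<open>j - i + l = m\<close>, where \<open>l\<close> is the power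
  of \<open>\<Delta>\<close> in the right factor.  The index set is finite, because the powers occurring
  in both factors are bounded above.  The upper argument of the binomial
  coefficient may be negative.\<close>

instantiation pdo :: (field_char_0) "{one, times}"
begin

lift_definition one_pdo :: "'a pdo" is "\<lambda>j. if j = 0 then 1 else 0"
  by (rule exI[of _ 0]) simp

lift_definition times_pdo :: "'a pdo \<Rightarrow> 'a pdo \<Rightarrow> 'a pdo" is
  "\<lambda>a b m n. \<Sum>(j, i) \<in> {(j, i :: nat). a j \<noteq> 0 \<and> b (m - j + int i) \<noteq> 0}.
     (of_int j gchoose i) * a j n * shift (j - int i) ((diff ^^ i) (b (m - j + int i))) n"
proof -
  fix a b :: "int \<Rightarrow> int \<Rightarrow> 'a"
  assume "\<exists>d. \<forall>j>d. a j = 0" "\<exists>d. \<forall>j>d. b j = 0"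
  then obtain d e where d: "\<forall>j>d. a j = 0" and e: "\<forall>j>e. b j = 0" by blast
  have "{(j, i :: nat). a j \<noteq> 0 \<and> b (m - j + int i) \<noteq> 0} = {}" if m: "m > d + e" for m
  proof -
    have "a j = 0 \<or> b (m - j + int i) = 0" for j and i :: nat
    proof (cases "j > d")
      case False
      then have "m - j + int i > e" using m by linarith
      then show ?thesis using e by blast
    qed (use d in blast)
    then show ?thesis by blast
  qed
  then show "\<exists>d. \<forall>m>d. (\<lambda>n. \<Sum>(j, i) \<in> {(j, i :: nat). a j \<noteq> 0 \<and> b (m - j + int i) \<noteq> 0}.
     (of_int j gchoose i) * a j n * shift (j - int i) ((diff ^^ i) (b (m - j + int i))) n) = 0"
    by (intro exI[of _ "d + e"] allI impI ext) (simp only: zero_fun_def sum.empty)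
qed

instance ..

end

instance pdo :: (field_char_0) power ..

lift_definition fop :: "(int \<Rightarrow> 'a::zero) \<Rightarrow> 'a pdo" is "\<lambda>f j. if j = 0 then f else 0"
  by (rule exI[of _ 0]) simp

lift_definition Dpow :: "int \<Rightarrow> 'a::zero_neq_one pdo" is "\<lambda>k j. if j = k then 1 else 0"
  by (metis less_irrefl)

lift_definition pos_part :: "'a::zero pdo \<Rightarrow> 'a pdo" is "\<lambda>a j. if j \<ge> 0 then a j else 0"
  by metis

definition neg_part :: "'a::ab_group_add pdo \<Rightarrow> 'a pdo" where
  "neg_part A = A - pos_part A"

definition commutator :: "'a::field_char_0 pdo \<Rightarrow> 'a pdo \<Rightarrow> 'a pdo" where
  "commutator A B = A * B - B * A"

definition pdo_inv :: "'a::field_char_0 pdo \<Rightarrow> 'a pdo" where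
  "pdo_inv A = (THE B. A * B = 1 \<and> B * A = 1)"

text \<open>Actions \<open>A(f)\<close> and \<open>A\<^sup>*(g)\<close> of a difference operator, that is, of an operator \<open>A\<close> without
  negative powers of \<open>\<Delta>\<close>; such an operator has finitely many terms \<open>a\<^sub>j \<Delta>\<^sup>j\<close>, and
  the adjoint of each is \<open>(\<Delta>\<^sup>*)\<^sup>j a\<^sub>j\<close>.\<close>

definition act :: "'a::field_char_0 pdo \<Rightarrow> (int \<Rightarrow> 'a) \<Rightarrow> int \<Rightarrow> 'a" where
  "act A f = (\<Sum>j | 0 \<le> j \<and> coeff A j \<noteq> 0. coeff A j * (diff ^^ nat j) f)"

definition adj_act :: "'a::field_char_0 pdo \<Rightarrow> (int \<Rightarrow> 'a) \<Rightarrow> int \<Rightarrow> 'a" where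
  "adj_act A g = (\<Sum>j | 0 \<le> j \<and> coeff A j \<noteq> 0. (diff_adj ^^ nat j) (coeff A j * g))"

section \<open>Actions involving a formal antidifference\<close>

text \<open>For an operator \<open>L = L\<^sub>+ + q \<Delta>\<^sup>-\<^sup>1 r\<close> the predicate below says that
  \<open>Q i = L\<^sup>i(q)\<close>, \<open>R j = (L\<^sup>*)\<^sup>j(r)\<close> and \<open>H i j = \<Delta>\<^sup>-\<^sup>1(Q i \<cdot> R j)\<close> for some choice of the
  summation constants of a formal antidifference.  Since \<open>\<Delta>\<^sup>* = -\<Delta> \<Lambda>\<^sup>-\<^sup>1\<close>, one has
  \<open>(\<Delta>\<^sup>-\<^sup>1)\<^sup>* = -\<Lambda> \<Delta>\<^sup>-\<^sup>1\<close>, which gives the sign and the shift in \<open>R (Suc j)\<close>.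

  \<^item> \<open>\<Delta>\<^sup>-\<^sup>1\<close> cannot be modelled by a linear map on all functions that inverts \<open>\<Delta>\<close> from both
    sides, because \<open>\<Delta>\<close> annihilates constants; so one antidifference is recorded for each of
    the products that occur.

  \<^item> The last clause is the rule \<open>\<Delta>\<^sup>-\<^sup>1(\<Delta> f) = f\<close> of formal calculation.  For \<open>L\<^sub>+ = \<Delta> + v\<close> with a
    function \<open>v\<close>, the other clauses give
    \<open>Q (i+1) R j - Q i R (j+1) = \<Delta> (Q i \<cdot> \<Lambda>\<^sup>-\<^sup>1(R j) + H i 0 \<cdot> H 0 j)\<close>,
    and the clause says that the antidifferences are related in the same way.  It only
    concerns summation constants, and it can always be met: the constants of all \<open>H i 0\<close>
    are arbitrary, and the clause determines \<open>H i (Suc j)\<close> recursively.\<close>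

definition formal_action ::
  "'a::field_char_0 pdo \<Rightarrow> (int \<Rightarrow> 'a) \<Rightarrow> (int \<Rightarrow> 'a) \<Rightarrow>
   (nat \<Rightarrow> int \<Rightarrow> 'a) \<Rightarrow> (nat \<Rightarrow> int \<Rightarrow> 'a) \<Rightarrow> (nat \<Rightarrow> nat \<Rightarrow> int \<Rightarrow> 'a) \<Rightarrow> bool" where
  "formal_action L q r Q R H \<longleftrightarrow>
     Q 0 = q \<and> R 0 = r \<and>
     (\<forall>i j. diff (H i j) = Q i * R j) \<and>
     (\<forall>i. Q (Suc i) = act (pos_part L) (Q i) + q * H i 0) \<and>
     (\<forall>j. R (Suc j) = adj_act (pos_part L) (R j) - r * shift 1 (H 0 j)) \<and>
     (\<forall>i j. H (Suc i) j - H i (Suc j) = Q i * shift (-1) (R j) + H i 0 * H 0 j)"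

section \<open>Times and derivatives\<close>

text \<open>The value of \<open>t\<^sub>l\<close> at \<open>t :: times\<close> is \<open>lookup t l\<close>, and \<open>t + single l x\<close> moves \<open>t\<^sub>l\<close> by \<open>x\<close>.
  Only finitely many times are nonzero at a given point, so that the sum over all
  times in the Orlov--Schulman operator is a pseudo-difference operator at every point.
  The times are numbered from 1; coordinate 0 is an inert parameter.\<close>

type_synonym times = "nat \<Rightarrow>\<^sub>0 real"

definition times_open :: "times set \<Rightarrow> bool" where
  "times_open U \<longleftrightarrow>
     (\<forall>t\<in>U. \<forall>l\<ge>1. \<forall>\<^sub>F x in nhds 0. t + Poly_Mapping.single l x \<in> U)"

text \<open>Derivatives at parameter value 0 of one-parameter families of functions and of
  operators.  A differentiable family of operators is required to be of bounded order near
  0; without this the coefficients of a product of two differentiable families need not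
  be differentiable.

  With a shift of \<open>t\<^sub>k\<close> as the parameter this gives \<open>\<partial>/\<partial>t\<^sub>k\<close>.  For an additional flow the
  parameter is an additional time \<open>s\<close>, and the flow is taken at a solution of the
  hierarchy, which is placed at \<open>s = 0\<close>.\<close>

definition has_fun_deriv :: "(real \<Rightarrow> int \<Rightarrow> 'a::real_normed_field) \<Rightarrow> (int \<Rightarrow> 'a) \<Rightarrow> bool" where
  "has_fun_deriv F F' \<longleftrightarrow> (\<forall>n. ((\<lambda>x. F x n) has_vector_derivative F' n) (at 0))"

definition has_op_deriv :: "(real \<Rightarrow> 'a::real_normed_field pdo) \<Rightarrow> 'a pdo \<Rightarrow> bool" where
  "has_op_deriv A A' \<longleftrightarrow>
     (\<exists>d. \<forall>\<^sub>F x in nhds 0. \<forall>j>d. coeff (A x) j = 0) \<and>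
     (\<forall>j n. ((\<lambda>x. coeff (A x) j n) has_vector_derivative coeff A' j n) (at 0))"

section \<open>The constrained discrete KP hierarchy\<close>

definition lax :: "(int \<Rightarrow> 'a::field_char_0) \<Rightarrow> (int \<Rightarrow> 'a) \<Rightarrow> 'a pdo" where
  "lax q r = Dpow 1 + fop q * Dpow (-1) * fop r"

definition cdKP ::
  "times set \<Rightarrow> (times \<Rightarrow> 'a::real_normed_field pdo) \<Rightarrow>
   (times \<Rightarrow> int \<Rightarrow> 'a) \<Rightarrow> (times \<Rightarrow> int \<Rightarrow> 'a) \<Rightarrow> bool" where
  "cdKP U L q r \<longleftrightarrow> times_open U \<and>
     (\<forall>t\<in>U. L t = lax (q t) (r t) \<and>
       (\<forall>k\<ge>1.
          has_op_deriv (\<lambda>x. L (t + Poly_Mapping.single k x))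
            (commutator (pos_part (L t ^ k)) (L t)) \<and>
          has_fun_deriv (\<lambda>x. q (t + Poly_Mapping.single k x)) (act (pos_part (L t ^ k)) (q t)) \<and>
          has_fun_deriv (\<lambda>x. r (t + Poly_Mapping.single k x))
            (- adj_act (pos_part (L t ^ k)) (r t))))"

definition dressing ::
  "times set \<Rightarrow> (times \<Rightarrow> 'a::real_normed_field pdo) \<Rightarrow> (times \<Rightarrow> 'a pdo) \<Rightarrow> bool" where
  "dressing U L W \<longleftrightarrow>
     (\<forall>t\<in>U. coeff (W t) 0 = 1 \<and> (\<forall>j>0. coeff (W t) j = 0) \<and>
       L t = W t * Dpow 1 * pdo_inv (W t) \<and>
       (\<forall>k\<ge>1. has_op_deriv (\<lambda>x. W (t + Poly_Mapping.single k x))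
                 (- (neg_part (L t ^ k) * W t))))"

definition bare_OS :: "nat \<Rightarrow> times \<Rightarrow> 'a::real_normed_field pdo" where
  "bare_OS k t =
     (\<Sum>l \<in> Poly_Mapping.keys t - {0}.
        fop (\<lambda>_. of_nat l * of_real (Poly_Mapping.lookup t l)) * Dpow (int l - int k))"

definition Orlov_Schulman :: "nat \<Rightarrow> 'a::real_normed_field pdo \<Rightarrow> times \<Rightarrow> 'a pdo" where
  "Orlov_Schulman k W t = W * bare_OS k t * pdo_inv W"

definition Xcoef :: "nat \<Rightarrow> nat \<Rightarrow> 'a::field_char_0" where
  "Xcoef k j = of_nat j - of_nat (k - 2) / 2"

text \<open>The operator \<open>X\<^sup>(\<^sup>1\<^sup>)\<^sub>k\<^sub>-\<^sub>1\<close>, and then its actions \<open>X(q)\<close> and \<open>X\<^sup>*(r)\<close>, for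
  \<open>Q\<close>, \<open>R\<close>, \<open>H\<close> as in \<^const>\<open>formal_action\<close>.  They use
  \<open>\<Delta>\<^sup>-\<^sup>1(R j \<cdot> q) = H 0 j\<close> and \<open>(\<Delta>\<^sup>-\<^sup>1)\<^sup>*(Q i \<cdot> r) = -\<Lambda>(H i 0)\<close>.  All three are meant for
  \<open>k \<ge> 2\<close>.\<close>

definition Xop :: "nat \<Rightarrow> (nat \<Rightarrow> int \<Rightarrow> 'a::field_char_0) \<Rightarrow> (nat \<Rightarrow> int \<Rightarrow> 'a) \<Rightarrow> 'a pdo" where
  "Xop k Q R = (\<Sum>j\<le>k - 2. fop (\<lambda>n. Xcoef k j * Q (k - 2 - j) n) * Dpow (-1) * fop (R j))"

definition Xact ::
  "nat \<Rightarrow> (nat \<Rightarrow> int \<Rightarrow> 'a::field_char_0) \<Rightarrow> (nat \<Rightarrow> nat \<Rightarrow> int \<Rightarrow> 'a) \<Rightarrow> int \<Rightarrow> 'a" where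
  "Xact k Q H = (\<Sum>j\<le>k - 2. (\<lambda>n. Xcoef k j * Q (k - 2 - j) n * H 0 j n))"

definition Xadj_act ::
  "nat \<Rightarrow> (nat \<Rightarrow> int \<Rightarrow> 'a::field_char_0) \<Rightarrow> (nat \<Rightarrow> nat \<Rightarrow> int \<Rightarrow> 'a) \<Rightarrow> int \<Rightarrow> 'a" where
  "Xadj_act k R H = (\<Sum>j\<le>k - 2. (\<lambda>n. - (Xcoef k j * R j n * shift 1 (H (k - 2 - j) 0) n)))"

section \<open>The integral type gauge transformation\<close>

definition T_I :: "(int \<Rightarrow> 'a::field_char_0) \<Rightarrow> 'a pdo" where
  "T_I r = fop (shift (-1) (recip r)) * Dpow (-1) * fop r"

definition gauge :: "'a::field_char_0 pdo \<Rightarrow> 'a pdo \<Rightarrow> 'a pdo" where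
  "gauge T A = T * A * pdo_inv T"

text \<open>\<open>T(f)\<close> for \<open>T = T_I r\<close>, where \<open>h = \<Delta>\<^sup>-\<^sup>1(r f)\<close>.\<close>

definition T_I_act :: "(int \<Rightarrow> 'a::field_char_0) \<Rightarrow> (int \<Rightarrow> 'a) \<Rightarrow> int \<Rightarrow> 'a" where
  "T_I_act r h = shift (-1) (recip r) * h"

text \<open>\<open>T\<^sup>*\<^sup>-\<^sup>1(g)\<close>, meant for \<open>T = T_I r\<close>: as \<open>(T\<^sup>*)\<^sup>-\<^sup>1 = (T\<^sup>-\<^sup>1)\<^sup>*\<close> and
  \<open>T\<^sup>-\<^sup>1 = r\<^sup>-\<^sup>1 \<Delta> \<Lambda>\<^sup>-\<^sup>1(r)\<close> is a difference operator, no antidifference is involved.\<close>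

definition adj_inv_act :: "'a::field_char_0 pdo \<Rightarrow> (int \<Rightarrow> 'a) \<Rightarrow> int \<Rightarrow> 'a" where
  "adj_inv_act T g = adj_act (pdo_inv T) g"

end

theory Submission
  imports Defs
begin

text \<open>Expanding \<open>\<Delta>\<^sup>j = (\<Lambda> - I)\<^sup>j\<close> in descending powers of \<open>\<Lambda>\<close> turns pseudo-difference operators into
  infinite matrices with entries \<open>(n, m)\<close> that vanish for \<open>m > n + d\<close>.  The product becomes the matrix product,
  \<open>A\<^sub>+\<close> the upper triangle with the diagonal, \<open>A\<^sup>*\<close> the transpose, and \<open>a \<Delta>\<^sup>-\<^sup>1 b\<close> the matrix with
  entries \<open>a(n) b(m)\<close> for \<open>m < n\<close>.

  Let \<open>V(g) = \<Lambda>\<^sup>-\<^sup>1(r\<^sup>-\<^sup>1) \<Delta>\<^sup>-\<^sup>1 T\<^sup>*\<^sup>-\<^sup>1(g)\<close>.  Any flow satisfies \<open>(\<partial>T) T\<^sup>-\<^sup>1 = V(\<partial>r)\<close>, and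
  \<open>(T A T\<^sup>-\<^sup>1)\<^sub>- = V(A\<^sub>+\<^sup>*(r)) + T A\<^sub>- T\<^sup>-\<^sup>1\<close>.  So a flow of \<open>L\<close> generated by \<open>-A\<^sub>-\<close> with \<open>\<partial>r = -A\<^sub>+\<^sup>*(r)\<close>
  goes over into the flow of \<open>T L T\<^sup>-\<^sup>1\<close> generated by \<open>-(T A T\<^sup>-\<^sup>1)\<^sub>-\<close>; this covers the times and the
  Orlov--Schulman part.  Summation by parts gives
  \<open>T Q\<^sub>i \<Delta>\<^sup>-\<^sup>1 R\<^sub>j T\<^sup>-\<^sup>1 = Qt\<^sub>i\<^sub>+\<^sub>1 \<Delta>\<^sup>-\<^sup>1 Rt\<^sub>j\<^sub>-\<^sub>1 - V(\<Lambda>(H\<^sub>i\<^sub>0) R\<^sub>j)\<close> with \<open>Rt\<^sub>-\<^sub>1 = 0\<close>.  The index shift in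
  the sum \<open>X\<close> raises its coefficients by 1, and the excess is the sum over \<open>i + j = k - 2\<close> of
  \<open>Qt\<^sub>i \<Delta>\<^sup>-\<^sup>1 Rt\<^sub>j\<close>, the negative part of \<open>(T L T\<^sup>-\<^sup>1)\<^sup>k\<^sup>-\<^sup>1\<close>, which generates the time flow with the
  opposite sign.\<close>

section \<open>Pseudo-difference operators as banded matrices\<close>

definition ord_le :: "'a::zero pdo \<Rightarrow> int \<Rightarrow> bool" where
  "ord_le A d \<longleftrightarrow> (\<forall>j>d. coeff A j = 0)"

lemma ord_le_ex: "\<exists>d. ord_le A d"
  using coeff[of A] by (simp add: ord_le_def)

lemma ord_le_mono: "ord_le A d \<Longrightarrow> d \<le> e \<Longrightarrow> ord_le A e"
  by (simp add: ord_le_def)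

lemma ord_leD: "ord_le A d \<Longrightarrow> j > d \<Longrightarrow> coeff A j = 0"
  by (simp add: ord_le_def)

section \<open>Coefficients of sums and products\<close>

lemma coeff_add: "coeff (A + B) j = coeff A j + coeff B j"
  by transfer simp

lemma coeff_uminus: "coeff (- A) j = - coeff A j"
  by transfer simp

lemma coeff_diff: "coeff (A - B) j = coeff A j - coeff B j"
  unfolding minus_pdo_def coeff_add coeff_uminus by simp

lemma coeff_zero: "coeff 0 j = 0"
  by transfer simp

lemma coeff_sum: "coeff (sum A I) j = (\<Sum>i\<in>I. coeff (A i) j)"
  by (induction I rule: infinite_finite_induct) (auto simp: coeff_add coeff_zero)

lemma coeff_one: "coeff 1 j = (if j = 0 then 1 else 0)"
  by transfer simp

lemma coeff_fop: "coeff (fop f) j = (if j = 0 then f else 0)"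
  by transfer simp

lemma coeff_Dpow: "coeff (Dpow k) j = (if j = k then 1 else 0)"
  by transfer simp

lemma coeff_pos_part: "coeff (pos_part A) j = (if j \<ge> 0 then coeff A j else 0)"
  by transfer simp

lemma coeff_neg_part: "coeff (neg_part A) j = (if j \<ge> 0 then 0 else coeff A j)"
  by (simp add: neg_part_def coeff_diff coeff_pos_part)

lemma pdo_eqI: "(\<And>j. coeff A j = coeff B j) \<Longrightarrow> A = B"
  by (rule iffD1[OF coeff_inject], rule ext)

lemma shift_apply: "shift k f n = f (n + k)"
  by (simp add: shift_def)

lemma diffs_zero: "(diff ^^ i) (0 :: int \<Rightarrow> 'a::ab_group_add) = 0"
  by (induction i) (simp_all add: diff_def zero_fun_def)

text \<open>The defining index set depends on the supports. A rectangle of power pairs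
  \<open>(j, l)\<close> with \<open>l = k - j + i\<close>, fixed by the order bounds alone, allows
  sums to be swapped and differentiated term by term. The parameter \<open>x\<close> lets one
  rectangle serve all \<open>k \<ge> x\<close>.\<close>

lemma coeff_times:
  fixes A B :: "'a::field_char_0 pdo"
  assumes A: "ord_le A d" and B: "ord_le B e" and x: "x \<le> k"
  shows "coeff (A * B) k n =
    (\<Sum>j\<in>{x-e..d}. \<Sum>l\<in>{x-d..e}. if k \<le> j + l
       then (of_int j gchoose nat (j+l-k)) * coeff A j n * (diff ^^ nat (j+l-k)) (coeff B l) (n + k - l)
       else 0)"
proof -
  let ?g = "\<lambda>(j::int, i::nat). (of_int j gchoose i) * coeff A j n
        * shift (j - int i) ((diff ^^ i) (coeff B (k - j + int i))) n"
  let ?S = "{(j, i :: nat). coeff A j \<noteq> 0 \<and> coeff B (k - j + int i) \<noteq> 0}"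
  let ?f = "\<lambda>(j,l). if k \<le> j + l
       then (of_int j gchoose nat (j+l-k)) * coeff A j n * (diff ^^ nat (j+l-k)) (coeff B l) (n + k - l)
       else 0"
  let ?P = "{p \<in> {x-e..d} \<times> {x-d..e}. k \<le> fst p + snd p}"
  have "coeff (A * B) k n = sum ?g ?S"
    by (simp only: times_pdo.rep_eq)
  also have "\<dots> = sum ?g ((\<lambda>(j,l). (j, nat (j+l-k))) ` ?P)"
  proof (rule sum.mono_neutral_left)
    show "?S \<subseteq> (\<lambda>(j,l). (j, nat (j+l-k))) ` ?P"
    proof clarify
      fix j and i :: nat
      assume nz: "coeff A j \<noteq> 0" "coeff B (k - j + int i) \<noteq> 0"
      have "j \<le> d" using nz(1) ord_leD[OF A, of j] by (cases "j \<le> d") simp_all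
      moreover have "k - j + int i \<le> e"
        using nz(2) ord_leD[OF B, of "k - j + int i"] by (cases "k - j + int i \<le> e") simp_all
      ultimately have "(j, k - j + int i) \<in> ?P" using x by simp
      then show "(j, i) \<in> (\<lambda>(j,l). (j, nat (j+l-k))) ` ?P"
        by (intro image_eqI[of _ _ "(j, k - j + int i)"]) simp_all
    qed
    show "\<forall>i\<in>(\<lambda>(j, l). (j, nat (j + l - k))) ` ?P - ?S. ?g i = 0"
    proof
      fix p assume "p \<in> (\<lambda>(j, l). (j, nat (j + l - k))) ` ?P - ?S"
      then show "?g p = 0"
        by (cases p) (auto simp: diffs_zero shift_apply)
    qed
  qed simp
  also have "\<dots> = sum ?f ?P"
  proof (subst sum.reindex)
    show "inj_on (\<lambda>(j,l). (j, nat (j+l-k))) ?P"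
      by (auto simp: inj_on_def)
    show "sum (?g \<circ> (\<lambda>(j,l). (j, nat (j+l-k)))) ?P = sum ?f ?P"
    proof (rule sum.cong[OF refl])
      fix p assume p: "p \<in> ?P"
      obtain j l where jl: "p = (j,l)" by (cases p)
      with p have "k \<le> j + l" by simp
      then have "int (nat (j+l-k)) = j + l - k" by simp
      then have "k - j + int (nat (j+l-k)) = l" "n + (j - int (nat (j+l-k))) = n + k - l" by linarith+
      then show "(?g \<circ> (\<lambda>(j,l). (j, nat (j+l-k)))) p = ?f p"
        using \<open>k \<le> j + l\<close> by (simp only: jl shift_apply o_def prod.case if_True)
    qed
  qed
  also have "\<dots> = sum ?f ({x-e..d} \<times> {x-d..e})"
    by (rule sum.mono_neutral_left) (auto split: if_splits)
  finally show ?thesis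
    by (simp add: sum.cartesian_product)
qed

lemma ord_le_times:
  fixes A B :: "'a::field_char_0 pdo"
  assumes A: "ord_le A d" and B: "ord_le B e"
  shows "ord_le (A * B) (d + e)"
proof -
  have "coeff (A * B) k n = 0" if "k > d + e" for k n
    using that by (simp add: coeff_times[OF A B order.refl])
  then show ?thesis by (auto simp: ord_le_def)
qed

text \<open>\<open>dker j x\<close> is the coefficient of \<open>\<Lambda>\<^sup>x\<close> in the expansion of \<open>(\<Lambda> - I)\<^sup>j\<close> in descending powers.\<close>

definition dker :: "int \<Rightarrow> int \<Rightarrow> 'a::field_char_0" where
  "dker j x = (if x \<le> j then (-1) ^ nat (j - x) * (of_int j gchoose nat (j - x)) else 0)"

text \<open>The condition \<open>m - n \<le> j\<close> drops only vanishing summands; as the order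
  of \<open>A\<close> is bounded above, it makes the index set finite.\<close>

definition ker :: "'a::field_char_0 pdo \<Rightarrow> int \<Rightarrow> int \<Rightarrow> 'a" where
  "ker A n m = (\<Sum>j | coeff A j \<noteq> 0 \<and> m - n \<le> j. coeff A j n * dker j (m - n))"

lemma ker_eq:
  assumes "ord_le A d" "x \<le> m - n"
  shows "ker A n m = (\<Sum>j\<in>{x..d}. coeff A j n * dker j (m - n))"
  unfolding ker_def
proof (rule sum.mono_neutral_left)
  show "{j. coeff A j \<noteq> 0 \<and> m - n \<le> j} \<subseteq> {x..d}"
    using assms by (auto simp: ord_le_def not_le[symmetric])
  show "\<forall>j\<in>{x..d} - {j. coeff A j \<noteq> 0 \<and> m - n \<le> j}. coeff A j n * dker j (m - n) = 0"
  proof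
    fix j assume "j \<in> {x..d} - {j. coeff A j \<noteq> 0 \<and> m - n \<le> j}"
    then show "coeff A j n * dker j (m - n) = 0"
      by (cases "m - n \<le> j") (auto simp: dker_def)
  qed
qed simp

text \<open>Binomial expansion of \<open>\<Lambda>^-s = (I - \<Delta> \<Lambda>^-1)^s\<close>,
  applied to \<open>b\<close> at \<open>y\<close>.\<close>

lemma diffs_alternating_sum:
  fixes b :: "int \<Rightarrow> 'a::field_char_0"
  shows "(\<Sum>i\<le>s. (-1) ^ i * of_nat (s choose i) * (diff ^^ i) b (y - int i)) = b (y - int s)"
proof (induction s arbitrary: y b)
  case (Suc s)
  have "(\<Sum>i\<le>Suc s. (-1) ^ i * of_nat (Suc s choose i) * (diff ^^ i) b (y - int i)) =
     (\<Sum>i\<le>s. (-1) ^ i * of_nat (s choose i) * (diff ^^ i) b (y - int i))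
     + (\<Sum>i\<le>s. (-1) ^ Suc i * of_nat (s choose i) * (diff ^^ Suc i) b (y - int (Suc i)))"
  proof -
    have "(\<Sum>i\<le>Suc s. (-1) ^ i * of_nat (Suc s choose i) * (diff ^^ i) b (y - int i)) =
      b y + (\<Sum>i\<le>s. (-1) ^ Suc i * of_nat (s choose Suc i) * (diff ^^ Suc i) b (y - int (Suc i)))
       + (\<Sum>i\<le>s. (-1) ^ Suc i * of_nat (s choose i) * (diff ^^ Suc i) b (y - int (Suc i)))"
      by (subst sum.atMost_Suc_shift) (simp add: sum.distrib[symmetric] algebra_simps)
    also have "b y + (\<Sum>i\<le>s. (-1) ^ Suc i * of_nat (s choose Suc i) * (diff ^^ Suc i) b (y - int (Suc i)))
      = (\<Sum>i\<le>Suc s. (-1) ^ i * of_nat (s choose i) * (diff ^^ i) b (y - int i))"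
      by (subst sum.atMost_Suc_shift) simp
    also have "\<dots> = (\<Sum>i\<le>s. (-1) ^ i * of_nat (s choose i) * (diff ^^ i) b (y - int i))"
      by simp
    finally show ?thesis .
  qed
  also have "(\<Sum>i\<le>s. (-1) ^ Suc i * of_nat (s choose i) * (diff ^^ Suc i) b (y - int (Suc i)))
    = - (\<Sum>i\<le>s. (-1) ^ i * of_nat (s choose i) * (diff ^^ i) (diff b) ((y - 1) - int i))"
    by (simp add: sum_negf[symmetric] funpow_swap1 algebra_simps)
  finally show ?case
    unfolding Suc.IH by (simp add: diff_def algebra_simps)
qed simp

text \<open>With \<open>y = n + j\<close>, both sides are the coefficient of
  \<open>\<Lambda>^(j+l-t)\<close> in \<open>\<Delta>^j b \<Delta>^l\<close>: on the left the
  Leibniz rule moves \<open>b\<close> out first, on the right \<open>\<Delta>^j\<close> is first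
  expanded in powers of \<Lambda>. Vandermonde's identity for \<open>(j - i) + l\<close> and
  trinomial revision reduce the inner sum to \<open>diffs_alternating_sum\<close>.\<close>

lemma leibniz_kernel:
  fixes b :: "int \<Rightarrow> 'a::field_char_0"
  shows "(\<Sum>i\<le>t. (of_int j gchoose i) * (diff ^^ i) b (y - int i)
            * ((-1) ^ (t - i) * (of_int (j + l - int i) gchoose (t - i))))
     = (\<Sum>s\<le>t. (-1) ^ s * (of_int j gchoose s) * b (y - int s)
            * ((-1) ^ (t - s) * (of_int l gchoose (t - s))))"
proof -
  let ?c = "\<lambda>i s. (of_int j gchoose i) * (diff ^^ i) b (y - int i) * (-1) ^ (t - i)
     * ((of_int j - of_nat i gchoose (s - i)) * (of_int l gchoose (t - s)))"
  have "(of_int j gchoose i) * (diff ^^ i) b (y - int i)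
            * ((-1) ^ (t - i) * (of_int (j + l - int i) gchoose (t - i))) = (\<Sum>s\<in>{i..t}. ?c i s)"
    if "i \<le> t" for i
  proof -
    have "(of_int (j + l - int i) :: 'a) = (of_int j - of_nat i) + of_int l"
      by simp
    then have "(of_int (j + l - int i) gchoose (t - i) :: 'a) = ((of_int j - of_nat i) + of_int l) gchoose (t - i)"
      by (rule arg_cong)
    also have "\<dots> = (\<Sum>s\<in>{0..t-i}. (of_int j - of_nat i gchoose s) * (of_int l gchoose (t - i - s)))"
      by (simp only: gbinomial_Vandermonde atMost_atLeast0)
    also have "\<dots> = (\<Sum>s\<in>{i..t}. (of_int j - of_nat i gchoose (s - i)) * (of_int l gchoose (t - s)))"
      by (rule sum.reindex_bij_witness[of _ "\<lambda>s. s - i" "\<lambda>s. s + i"]) (use that in \<open>auto simp: add.commute\<close>)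
    finally show ?thesis by (simp add: sum_distrib_left mult.assoc)
  qed
  then have "(\<Sum>i\<le>t. (of_int j gchoose i) * (diff ^^ i) b (y - int i)
            * ((-1) ^ (t - i) * (of_int (j + l - int i) gchoose (t - i))))
     = (\<Sum>i\<le>t. \<Sum>s\<in>{i..t}. ?c i s)" by simp
  also have "\<dots> = (\<Sum>s\<le>t. \<Sum>i\<le>s. ?c i s)"
    by (rule trans[OF sum.Sigma trans[OF sum.reindex_bij_witness[of _ "\<lambda>(s,i). (i,s)" "\<lambda>(i,s). (s,i)"] sum.Sigma[symmetric]]]) auto
  also have "\<dots> = (\<Sum>s\<le>t. (-1) ^ s * (of_int j gchoose s) * b (y - int s)
            * ((-1) ^ (t - s) * (of_int l gchoose (t - s))))"
  proof (rule sum.cong[OF refl])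
    fix s assume "s \<in> {..t}" then have s: "s \<le> t" by simp
    have "?c i s = (of_int j gchoose s) * (of_int l gchoose (t - s)) * (-1)^t
       * ((-1) ^ i * of_nat (s choose i) * (diff ^^ i) b (y - int i))" if "i \<le> s" for i
    proof -
      have c: "(of_int j gchoose i) * (of_int j - of_nat i gchoose (s - i)) =
         (of_int j gchoose s) * (of_nat (s choose i) :: 'a)"
        using gbinomial_trinomial_revision[OF that, of "of_int j :: 'a"] by (simp add: binomial_gbinomial)
      have p: "(-1 :: 'a) ^ (t - i) = (-1)^t * (-1)^i"
        using s that by (auto simp: minus_one_power_iff)
      have "?c i s = ((of_int j gchoose i) * (of_int j - of_nat i gchoose (s - i)))
         * ((diff ^^ i) b (y - int i) * (-1) ^ (t - i) * (of_int l gchoose (t - s)))"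
        by (simp only: mult_ac)
      then show ?thesis
        unfolding c p by (simp only: mult_ac)
    qed
    then have "(\<Sum>i\<le>s. ?c i s) = (\<Sum>i\<le>s. (of_int j gchoose s) * (of_int l gchoose (t - s)) * (-1)^t
       * ((-1) ^ i * of_nat (s choose i) * (diff ^^ i) b (y - int i)))"
      by (intro sum.cong[OF refl]) (simp only: atMost_iff)
    also have "\<dots> = (of_int j gchoose s) * (of_int l gchoose (t - s)) * (-1)^t * b (y - int s)"
      by (simp only: sum_distrib_left[symmetric] diffs_alternating_sum)
    also have "(-1 :: 'a)^t = (-1)^s * (-1)^(t - s)"
      using s by (simp add: power_add[symmetric])
    finally show "(\<Sum>i\<le>s. ?c i s) = (-1) ^ s * (of_int j gchoose s) * b (y - int s)
            * ((-1) ^ (t - s) * (of_int l gchoose (t - s)))"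
      by (simp add: mult_ac)
  qed
  finally show ?thesis .
qed

text \<open>The case of two monomials in \<open>ker_times\<close>: the product rule on the left, the
  matrix product on the right.\<close>

lemma ker_times_term:
  fixes b :: "int \<Rightarrow> 'a::field_char_0"
  assumes j: "j \<le> d" and l: "l \<le> e"
  shows "(\<Sum>k\<in>{m-n..d+e}. (if k \<le> j + l
       then (of_int j gchoose nat (j+l-k)) * c * (diff ^^ nat (j+l-k)) b (n + k - l)
       else 0) * dker k (m - n)) =
    (\<Sum>p\<in>{m-e..n+d}. (c * dker j (p - n)) * (b p * dker l (m - p)))"
proof (cases "m - n \<le> j + l")
  case False
  have "dker j (p - n) = (0::'a) \<or> dker l (m - p) = (0::'a)" for p
    using False by (auto simp: dker_def)
  then have "(c * dker j (p - n)) * (b p * dker l (m - p)) = 0" for p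
    by (metis mult_zero_right mult_zero_left)
  then show ?thesis
    using False by (intro trans[OF sum.neutral sum.neutral[symmetric]]) auto
next
  case True
  \<comment> \<open>\<open>t\<close> is the distance from the top power \<open>j + l\<close> of
    \<Lambda> down to the power \<open>m - n\<close> in question.\<close>
  define t where "t = nat (j + l - (m - n))"
  have t: "int t = j + l - (m - n)" using True by (simp add: t_def)
  have "(\<Sum>k\<in>{m-n..d+e}. (if k \<le> j + l
       then (of_int j gchoose nat (j+l-k)) * c * (diff ^^ nat (j+l-k)) b (n + k - l)
       else 0) * dker k (m - n)) =
    (\<Sum>k\<in>{m-n..j+l}. (of_int j gchoose nat (j+l-k)) * c * (diff ^^ nat (j+l-k)) b (n + k - l) * dker k (m - n))"
    using j l by (intro sum.mono_neutral_cong_right) auto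
  also have "\<dots> = (\<Sum>i\<le>t. c * ((of_int j gchoose i) * (diff ^^ i) b (n + j - int i)
            * ((-1) ^ (t - i) * (of_int (j + l - int i) gchoose (t - i)))))"
  proof (rule sum.reindex_bij_witness[of _ "\<lambda>i. j + l - int i" "\<lambda>k. nat (j + l - k)"])
    fix k assume "k \<in> {m-n..j+l}"
    then have k: "m - n \<le> k" "k \<le> j + l" by auto
    define i where "i = nat (j + l - k)"
    have i: "int i = j + l - k" using k by (simp add: i_def)
    then have kk: "k = j + l - int i" by simp
    have n: "nat (k - (m - n)) = t - i" using i t k by linarith
    have y: "n + k - l = n + j - int i" using i by simp
    have dk: "dker k (m - n) = (-1) ^ (t - i) * ((of_int (j + l - int i) gchoose (t - i)) :: 'a)"
      unfolding dker_def n using k(1) kk by simp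
    show "c * ((of_int j gchoose nat (j + l - k)) * (diff ^^ nat (j + l - k)) b (n + j - int (nat (j + l - k)))
            * ((-1) ^ (t - nat (j + l - k)) * (of_int (j + l - int (nat (j + l - k))) gchoose (t - nat (j + l - k)))))
       = (of_int j gchoose nat (j+l-k)) * c * (diff ^^ nat (j+l-k)) b (n + k - l) * dker k (m - n)"
      unfolding i_def[symmetric] dk y by (simp only: mult_ac)
  qed (use t in auto)
  also have "\<dots> = c * (\<Sum>s\<le>t. (-1) ^ s * (of_int j gchoose s) * b (n + j - int s)
            * ((-1) ^ (t - s) * (of_int l gchoose (t - s))))"
    by (simp only: sum_distrib_left[symmetric] leibniz_kernel)
  also have "\<dots> = (\<Sum>p\<in>{m-l..n+j}. (c * dker j (p - n)) * (b p * dker l (m - p)))"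
    unfolding sum_distrib_left
  proof (rule sum.reindex_bij_witness[of _ "\<lambda>p. nat (n + j - p)" "\<lambda>s. n + j - int s"])
    fix s assume "s \<in> {..t}"
    then have s: "int s \<le> int t" by simp
    have "nat (j - (n + j - int s - n)) = s" "nat (l - (m - (n + j - int s))) = t - s"
      using s t by linarith+
    then have dk: "dker j (n + j - int s - n) = (-1)^s * (of_int j gchoose s :: 'a)"
       "dker l (m - (n + j - int s)) = (-1)^(t-s) * (of_int l gchoose (t - s) :: 'a)"
      unfolding dker_def using s t by auto
    show "(c * dker j (n + j - int s - n)) * (b (n + j - int s) * dker l (m - (n + j - int s)))
      = c * ((-1) ^ s * (of_int j gchoose s) * b (n + j - int s)
            * ((-1) ^ (t - s) * (of_int l gchoose (t - s))))"
      unfolding dk by (simp only: mult_ac)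
  qed (use t in auto)
  also have "\<dots> = (\<Sum>p\<in>{m-e..n+d}. (c * dker j (p - n)) * (b p * dker l (m - p)))"
    using j l by (intro sum.mono_neutral_left) (auto simp: dker_def)
  finally show ?thesis .
qed

text \<open>All sums are finite and are exchanged until \<open>ker_times_term\<close> treats each
  pair \<open>(j, l)\<close>. The lower ends of \<open>?J\<close> and \<open>?L\<close> are low
  enough for \<open>ker_eq\<close> at every inner index \<open>p\<close>.\<close>

lemma ker_times:
  fixes A B :: "'a::field_char_0 pdo"
  assumes A: "ord_le A d" and B: "ord_le B e"
  shows "ker (A * B) n m = (\<Sum>p\<in>{m-e..n+d}. ker A n p * ker B p m)"
proof -
  let ?J = "{m-n-e..d}" and ?L = "{m-n-d..e}"
  let ?f = "\<lambda>k j l. (if k \<le> j + l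
       then (of_int j gchoose nat (j+l-k)) * coeff A j n * (diff ^^ nat (j+l-k)) (coeff B l) (n + k - l)
       else 0) * dker k (m - n)"
  let ?g = "\<lambda>p j l. (coeff A j n * dker j (p - n)) * (coeff B l p * dker l (m - p))"
  have "ker (A * B) n m = (\<Sum>k\<in>{m-n..d+e}. coeff (A * B) k n * dker k (m - n))"
    by (rule ker_eq[OF ord_le_times[OF A B] order.refl])
  also have "\<dots> = (\<Sum>k\<in>{m-n..d+e}. \<Sum>j\<in>?J. \<Sum>l\<in>?L. ?f k j l)"
  proof (rule sum.cong[OF refl])
    fix k assume "k \<in> {m-n..d+e}"
    then show "coeff (A * B) k n * dker k (m - n) = (\<Sum>j\<in>?J. \<Sum>l\<in>?L. ?f k j l)"
      by (subst coeff_times[OF A B, of "m-n"]) (simp_all only: sum_distrib_right atLeastAtMost_iff)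
  qed
  also have "\<dots> = (\<Sum>j\<in>?J. \<Sum>k\<in>{m-n..d+e}. \<Sum>l\<in>?L. ?f k j l)"
    by (rule sum.swap)
  also have "\<dots> = (\<Sum>j\<in>?J. \<Sum>l\<in>?L. \<Sum>k\<in>{m-n..d+e}. ?f k j l)"
    by (intro sum.cong refl sum.swap)
  also have "\<dots> = (\<Sum>j\<in>?J. \<Sum>l\<in>?L. \<Sum>p\<in>{m-e..n+d}. ?g p j l)"
    by (intro sum.cong refl ker_times_term) auto
  also have "\<dots> = (\<Sum>j\<in>?J. \<Sum>p\<in>{m-e..n+d}. \<Sum>l\<in>?L. ?g p j l)"
    by (intro sum.cong refl sum.swap)
  also have "\<dots> = (\<Sum>p\<in>{m-e..n+d}. \<Sum>j\<in>?J. \<Sum>l\<in>?L. ?g p j l)"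
    by (rule sum.swap)
  also have "\<dots> = (\<Sum>p\<in>{m-e..n+d}. ker A n p * ker B p m)"
  proof (rule sum.cong[OF refl])
    fix p assume "p \<in> {m-e..n+d}"
    then have "m-n-e \<le> p-n" "m-n-d \<le> m-p" by auto
    then show "(\<Sum>j\<in>?J. \<Sum>l\<in>?L. ?g p j l) = ker A n p * ker B p m"
      by (simp only: ker_eq[OF A] ker_eq[OF B] sum_product)
  qed
  finally show ?thesis .
qed

section \<open>Matrices of sums and of the basic operators\<close>

lemma ker_eq_0: "ord_le A d \<Longrightarrow> m > n + d \<Longrightarrow> ker A n m = 0"
  by (simp add: ker_eq[of A d "m - n"])

lemma ker_top: "ord_le A d \<Longrightarrow> ker A n (n + d) = coeff A d n"
  by (simp add: ker_eq[of A d d] dker_def)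

lemma ker_add: "ker (A + B) n m = ker A n m + ker B n m"
proof -
  obtain d e where "ord_le A d" "ord_le B e" using ord_le_ex by blast
  then have "ord_le A (max d e)" "ord_le B (max d e)" "ord_le (A + B) (max d e)"
    by (auto simp: ord_le_def coeff_add)
  then show ?thesis
    by (simp add: ker_eq[OF _ order.refl] coeff_add algebra_simps sum.distrib)
qed

lemma ker_uminus: "ker (- A) n m = - ker A n m"
  by (simp add: ker_def coeff_uminus sum_negf)

lemma ker_diff: "ker (A - B) n m = ker A n m - ker B n m"
  using ker_add[of "A - B" B n m] by simp

lemma ker_zero: "ker 0 n m = 0"
  by (simp add: ker_def coeff_zero)

lemma ker_sum: "ker (sum A I) n m = (\<Sum>i\<in>I. ker (A i) n m)"
  by (induction I rule: infinite_finite_induct) (auto simp: ker_add ker_zero)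

text \<open>The outermost diagonal is the leading coefficient, so vanishing entries lower the order
  bound by one, again and again. Hence an operator is determined by its matrix.\<close>

lemma ker_eq_0_imp:
  fixes A :: "'a::field_char_0 pdo"
  assumes "\<And>n m. ker A n m = 0"
  shows "A = 0"
proof (rule pdo_eqI)
  obtain d where d: "ord_le A d" using ord_le_ex by blast
  have "ord_le A (d - int i)" for i
  proof (induction i)
    case (Suc i)
    have "coeff A (d - int i) = 0"
      using ker_top[OF Suc] assms by (auto simp: fun_eq_iff)
    show ?case
      unfolding ord_le_def
    proof (intro allI impI)
      fix j assume "j > d - int (Suc i)"
      then have "j > d - int i \<or> j = d - int i" by auto
      then show "coeff A j = 0"
        using \<open>coeff A (d - int i) = 0\<close> ord_leD[OF Suc] by blast
    qed
  qed (use d in simp)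
  then have "coeff A j = 0" for j
    by (rule ord_leD[of A "d - int (nat (d - j + 1))"]) simp
  then show "coeff A j = coeff 0 j" for j
    by (simp add: coeff_zero)
qed

lemma pdo_ker_eqI: "(\<And>n m. ker A n m = ker B n m) \<Longrightarrow> A = B"
  using ker_eq_0_imp[of "A - B"] by (simp add: ker_diff)

lemma ker_fop: "ker (fop f) n m = (if m = n then f n else 0)"
proof -
  have "ord_le (fop f) 0" by (simp add: ord_le_def coeff_fop)
  have "ker (fop f) n m = (\<Sum>j\<in>{min (m-n) 0..0}. coeff (fop f) j n * dker j (m-n))"
    by (rule ker_eq) (simp_all add: ord_le_def coeff_fop)
  also have "\<dots> = (\<Sum>j\<in>{0}. coeff (fop f) j n * dker j (m-n))"
    by (rule sum.mono_neutral_right) (auto simp: coeff_fop)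
  finally show ?thesis
    by (auto simp: coeff_fop dker_def gbinomial_0_left)
qed

lemma ker_Dpow: "ker (Dpow k) n m = dker k (m - n)"
proof -
  have "ker (Dpow k) n m = (\<Sum>j\<in>{min (m-n) k..k}. coeff (Dpow k) j n * dker j (m-n))"
    by (rule ker_eq) (simp_all add: ord_le_def coeff_Dpow)
  also have "\<dots> = (\<Sum>j\<in>{k}. coeff (Dpow k) j n * dker j (m-n))"
    by (rule sum.mono_neutral_right) (auto simp: coeff_Dpow)
  finally show ?thesis
    by (simp add: coeff_Dpow)
qed

lemma one_eq_fop: "(1 :: 'a::field_char_0 pdo) = fop 1"
  by (rule pdo_eqI) (simp add: coeff_one coeff_fop)

lemma ker_one: "ker 1 n m = (if m = n then 1 else 0)"
  by (simp add: one_eq_fop ker_fop)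

text \<open>For \<open>j \<ge> 0\<close> the expansion of \<open>(\<Lambda> - I)^j\<close> is an
  ordinary polynomial in \<Lambda>.\<close>

lemma dker_nonneg: "j \<ge> 0 \<Longrightarrow> x < 0 \<Longrightarrow> dker j x = (0 :: 'a::field_char_0)"
proof -
  assume a: "j \<ge> 0" "x < 0"
  then obtain a where j: "j = int a" by (metis nonneg_int_cases)
  have "(of_nat a :: 'a) gchoose nat (int a - x) = of_nat (a choose nat (int a - x))"
    by (simp add: binomial_gbinomial)
  also have "\<dots> = 0" using a by (simp add: binomial_eq_0)
  finally show ?thesis by (simp add: dker_def j)
qed

lemma dker_1: "dker 1 x = (if x = 1 then 1 else if x = 0 then - 1 else (0 :: 'a::field_char_0))"
  using dker_nonneg[of 1 x] by (auto simp: dker_def not_less)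

text \<open>The geometric series
  \<open>(\<Lambda> - I)^-1 = \<Lambda>^-1 + \<Lambda>^-2 + ...\<close>.\<close>

lemma dker_m1: "dker (-1) x = (if x < 0 then 1 else (0 :: 'a::field_char_0))"
proof -
  have "(-1) ^ k * ((-1 :: 'a) gchoose k) = 1" for k
    using gbinomial_minus[of "1::'a" k] by (simp add: binomial_gbinomial[symmetric] power_mult_distrib[symmetric])
  then show ?thesis by (auto simp: dker_def)
qed

text \<open>Non-negative powers of \<Delta> expand into non-negative powers of \<Lambda> and
  negative powers into negative ones, so the split by powers of \<Delta> is a split along the
  diagonal.\<close>

lemma ker_pos_part: "ker (pos_part A) n m = (if m \<ge> n then ker A n m else 0)"
proof -
  obtain d0 where "ord_le A d0" using ord_le_ex by blast
  define d where "d = max d0 0"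
  have d: "ord_le A d" "ord_le (pos_part A) d"
    using \<open>ord_le A d0\<close> by (auto simp: ord_le_def d_def coeff_pos_part)
  have "ker (pos_part A) n m = (\<Sum>j\<in>{m-n..d}. coeff (pos_part A) j n * dker j (m-n))"
    by (rule ker_eq[OF d(2) order.refl])
  also have "\<dots> = (\<Sum>j\<in>{m-n..d}. if m \<ge> n then coeff A j n * dker j (m-n) else 0)"
    by (rule sum.cong) (auto simp: coeff_pos_part dker_nonneg)
  also have "\<dots> = (if m \<ge> n then ker A n m else 0)"
    by (simp add: ker_eq[OF d(1) order.refl])
  finally show ?thesis .
qed

lemma ker_neg_part: "ker (neg_part A) n m = (if m < n then ker A n m else 0)"
  by (simp add: neg_part_def ker_diff ker_pos_part)

text \<open>Associativity is that of matrix products, once the inner sums are extended by vanishing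
  entries to ranges independent of the outer index.\<close>

instance pdo :: (field_char_0) ring_1
proof
  fix A B C :: "'a pdo"
  obtain d e f where d: "ord_le A d" "ord_le B e" "ord_le C f" using ord_le_ex by metis
  show "A * B * C = A * (B * C)"
  proof (rule pdo_ker_eqI)
    fix n m
    have "ker (A * B * C) n m = (\<Sum>p\<in>{m-f..n+(d+e)}. (\<Sum>s\<in>{m-(e+f)..n+d}. ker A n s * ker B s p) * ker C p m)"
      unfolding ker_times[OF ord_le_times[OF d(1,2)] d(3)] ker_times[OF d(1,2)]
    proof (rule sum.cong[OF refl], rule arg_cong2[where f = "(*)", OF _ refl], rule sum.mono_neutral_left)
      fix p assume "p \<in> {m-f..n+(d+e)}"
      then show "{p-e..n+d} \<subseteq> {m-(e+f)..n+d}" by auto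
      show "\<forall>i\<in>{m-(e+f)..n+d} - {p-e..n+d}. ker A n i * ker B i p = 0"
        by (auto simp: ker_eq_0[OF d(2)])
    qed auto
    also have "\<dots> = (\<Sum>p\<in>{m-f..n+(d+e)}. \<Sum>s\<in>{m-(e+f)..n+d}. ker A n s * (ker B s p * ker C p m))"
      by (simp only: sum_distrib_right mult.assoc)
    also have "\<dots> = (\<Sum>s\<in>{m-(e+f)..n+d}. \<Sum>p\<in>{m-f..n+(d+e)}. ker A n s * (ker B s p * ker C p m))"
      by (rule sum.swap)
    also have "\<dots> = (\<Sum>s\<in>{m-(e+f)..n+d}. ker A n s * (\<Sum>p\<in>{m-f..n+(d+e)}. ker B s p * ker C p m))"
      by (simp only: sum_distrib_left)
    also have "\<dots> = ker (A * (B * C)) n m"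
      unfolding ker_times[OF d(1) ord_le_times[OF d(2,3)]] ker_times[OF d(2,3)]
    proof (rule sum.cong[OF refl], rule arg_cong2[where f = "(*)", OF refl], rule sum.mono_neutral_right)
      fix s assume "s \<in> {m-(e+f)..n+d}"
      then show "{m-f..s+e} \<subseteq> {m-f..n+(d+e)}" by auto
      show "\<forall>i\<in>{m-f..n+(d+e)} - {m-f..s+e}. ker B s i * ker C i m = 0"
        by (auto simp: ker_eq_0[OF d(2)])
    qed auto
    finally show "ker (A * B * C) n m = ker (A * (B * C)) n m" .
  qed
  define g where "g = max d (max e f)"
  have g: "ord_le A g" "ord_le B g" "ord_le C g" "ord_le (A + B) g" "ord_le (B + C) g"
    using d by (auto simp: ord_le_def g_def coeff_add)
  show "(A + B) * C = A * C + B * C"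
    by (rule pdo_ker_eqI) (simp add: ker_times[OF g(4,3)] ker_times[OF g(1,3)] ker_times[OF g(2,3)] ker_add
        algebra_simps sum.distrib)
  show "A * (B + C) = A * B + A * C"
    by (rule pdo_ker_eqI) (simp add: ker_times[OF g(1,5)] ker_times[OF g(1,3)] ker_times[OF g(1,2)] ker_add
        algebra_simps sum.distrib)
  have o: "ord_le (1 :: 'a pdo) 0" by (simp add: ord_le_def coeff_one)
  show "1 * A = A"
    by (rule pdo_ker_eqI) (auto simp: ker_times[OF o d(1)] ker_one if_distrib[where f = "\<lambda>x. x * _"]
        ker_eq_0[OF d(1)] not_le cong: if_cong)
  show "A * 1 = A"
    by (rule pdo_ker_eqI) (auto simp: ker_times[OF d(1) o] ker_one if_distrib[where f = "\<lambda>x. _ * x"]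
        ker_eq_0[OF d(1)] not_le cong: if_cong)
  show "(0 :: 'a pdo) \<noteq> 1"
    by (metis coeff_one coeff_zero zero_neq_one zero_fun_def one_fun_def)
qed

section \<open>Calculus with the antidifference\<close>

abbreviation (input) delta :: "'a::field_char_0 pdo" where
  "delta \<equiv> Dpow 1"

abbreviation (input) antidelta :: "'a::field_char_0 pdo" where
  "antidelta \<equiv> Dpow (-1)"

lemma sum_fun_apply: "(sum f A) x = (\<Sum>i\<in>A. f i x)"
  by (induction A rule: infinite_finite_induct) auto

lemma ord_le_fop: "ord_le (fop f) 0"
  by (simp add: ord_le_def coeff_fop)

lemma ord_le_Dpow: "ord_le (Dpow k) k"
  by (simp add: ord_le_def coeff_Dpow)

lemma ker_fop_times: "ker (fop f * A) n m = f n * ker A n m"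
proof -
  obtain d where d: "ord_le A d" using ord_le_ex by blast
  show ?thesis
    by (auto simp: ker_times[OF ord_le_fop d] ker_fop if_distrib[where f = "\<lambda>x. x * _"]
        ker_eq_0[OF d] not_le cong: if_cong)
qed

lemma ker_times_fop: "ker (A * fop f) n m = ker A n m * f m"
proof -
  obtain d where d: "ord_le A d" using ord_le_ex by blast
  have "ker (A * fop f) n m = (\<Sum>p\<in>{m..n+d}. if m = p then ker A n p * f p else 0)"
    unfolding ker_times[OF d ord_le_fop] by (rule sum.cong) (auto simp: ker_fop)
  then show ?thesis
    by (auto simp: ker_eq_0[OF d] not_le)
qed

lemma ker_delta_times: "ker (delta * A) n m = ker A (n + 1) m - ker A n m"
proof -
  obtain d where d: "ord_le A d" using ord_le_ex by blast
  have "ker (delta * A) n m = (\<Sum>p\<in>{min (m - d) n..n+1}. dker 1 (p - n) * ker A p m)"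
    unfolding ker_times[OF ord_le_Dpow d]
    by (rule sum.mono_neutral_cong_left) (auto simp: ker_Dpow ker_eq_0[OF d])
  also have "\<dots> = (\<Sum>p\<in>{n, n+1}. dker 1 (p - n) * ker A p m)"
    by (rule sum.mono_neutral_right) (auto simp: dker_1)
  finally show ?thesis by (simp add: dker_1)
qed

lemma fop_mult: "fop (f * g) = fop f * fop g"
  by (rule pdo_ker_eqI) (simp add: ker_fop_times ker_fop)

lemma fop_add: "fop (f + g) = fop f + (fop g :: 'a::field_char_0 pdo)"
  by (rule pdo_ker_eqI) (simp add: ker_add ker_fop)

lemma delta_antidelta: "delta * antidelta = (1 :: 'a::field_char_0 pdo)"
  by (rule pdo_ker_eqI) (simp add: ker_delta_times ker_Dpow dker_m1 ker_one)

lemma antidelta_delta: "antidelta * delta = (1 :: 'a::field_char_0 pdo)"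
proof (rule pdo_ker_eqI)
  fix n m :: int
  have "ker (antidelta * delta) n m = (\<Sum>p\<in>{m-1..n-1}. dker (-1) (p - n) * (dker 1 (m - p) :: 'a))"
    by (simp add: ker_times[OF ord_le_Dpow ord_le_Dpow] ker_Dpow)
  also have "\<dots> = (\<Sum>p\<in>{m-1..n-1} \<inter> {m-1,m}. dker (-1) (p - n) * (dker 1 (m - p) :: 'a))"
    by (rule sum.mono_neutral_right) (auto simp: dker_1)
  also have "{m-1..n-1} \<inter> {m-1,m} = (if m < n then {m-1,m} else if m = n then {m-1} else {})"
    by auto
  finally show "ker (antidelta * delta) n m = (ker 1 n m :: 'a)"
    by (auto simp: dker_1 dker_m1 ker_one)
qed

lemma delta_fop: "delta * fop f = fop (shift 1 f) * delta + fop (diff f)"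
  by (rule pdo_ker_eqI)
     (simp add: ker_delta_times ker_fop ker_add ker_fop_times ker_Dpow dker_1 shift_def diff_def)

text \<open>Multiplication by \<Delta> from the left reduces this to the product rule for
  \<open>\<Delta>\<close> and \<open>\<Lambda>^-1(g)\<close>, because the adjoint of \<Delta> is
  \<open>- \<Delta> \<Lambda>^-1\<close>.\<close>

lemma antidelta_fop_delta:
  "antidelta * fop g * delta = fop (shift (-1) g) + antidelta * fop (diff_adj g)"
proof -
  have *: "diff (shift (-1) g) = - diff_adj g" "shift 1 (shift (-1) g) = g"
    by (simp_all add: diff_def diff_adj_def shift_def fun_eq_iff)
  have "delta * (fop (shift (-1) g) + antidelta * fop (diff_adj g)) =
     fop g * delta + fop (- diff_adj g + diff_adj g)"
    by (simp only: distrib_left delta_fop * mult.assoc[symmetric] delta_antidelta mult_1_left fop_add add.assoc)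
  also have "fop (- diff_adj g + diff_adj g) = 0"
    by (rule pdo_ker_eqI) (simp add: ker_fop ker_zero)
  finally have "antidelta * (delta * (fop (shift (-1) g) + antidelta * fop (diff_adj g)))
    = antidelta * (fop g * delta)" by simp
  then show ?thesis
    by (simp only: mult.assoc[symmetric] antidelta_delta mult_1_left)
qed

text \<open>Named after semiseparable matrices: the strict lower triangle is cut out of a matrix of
  rank one.\<close>

definition semisep :: "(int \<Rightarrow> 'a::field_char_0) \<Rightarrow> (int \<Rightarrow> 'a) \<Rightarrow> 'a pdo" where
  "semisep a b = fop a * antidelta * fop b"

lemma ker_semisep: "ker (semisep a b) n m = (if m < n then a n * b m else 0)"
  by (simp add: semisep_def ker_times_fop ker_fop_times ker_Dpow dker_m1)

lemma semisep_add_left: "semisep (a + b) c = semisep a c + semisep b c"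
  by (rule pdo_ker_eqI) (simp add: ker_semisep ker_add algebra_simps)

lemma semisep_add_right: "semisep a (b + c) = semisep a b + semisep a c"
  by (rule pdo_ker_eqI) (simp add: ker_semisep ker_add algebra_simps)

lemma semisep_uminus_right: "semisep a (- b) = - semisep a b"
  by (rule pdo_ker_eqI) (simp add: ker_semisep ker_uminus)

lemma semisep_zero: "semisep a 0 = 0" "semisep 0 b = 0"
  by (rule pdo_ker_eqI, simp add: ker_semisep ker_zero)+

lemma semisep_sum_right: "semisep a (sum b I) = (\<Sum>i\<in>I. semisep a (b i))"
  by (rule pdo_ker_eqI) (simp add: ker_semisep ker_sum sum_fun_apply sum_distrib_left)

lemma ord_le_semisep: "ord_le (semisep a b) (-1)"
  using ord_le_times[OF ord_le_times[OF ord_le_fop ord_le_Dpow] ord_le_fop, of a "-1" b]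
  by (simp add: semisep_def)

section \<open>Splitting into non-negative and negative powers\<close>

lemma neg_part_eq_self: "ord_le A (-1) \<Longrightarrow> neg_part A = A"
  by (rule pdo_eqI) (auto simp: coeff_neg_part ord_le_def)

lemma pos_part_eq_0: "ord_le A (-1) \<Longrightarrow> pos_part A = 0"
  using neg_part_eq_self[of A] by (simp add: neg_part_def)

lemma ord_le_neg_part: "ord_le (neg_part A) (-1)"
  by (auto simp: ord_le_def coeff_neg_part)

lemma neg_part_add: "neg_part (A + B) = neg_part A + neg_part B"
  by (rule pdo_eqI) (simp add: coeff_neg_part coeff_add)

lemma pos_part_add: "pos_part (A + B) = pos_part A + pos_part B"
  by (rule pdo_eqI) (simp add: coeff_pos_part coeff_add)

lemma pos_part_sum: "pos_part (sum A I) = (\<Sum>i\<in>I. pos_part (A i))"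
  by (rule pdo_eqI) (simp add: coeff_pos_part coeff_sum)

lemma neg_part_sum: "neg_part (sum A I) = (\<Sum>i\<in>I. neg_part (A i))"
  by (rule pdo_eqI) (simp add: coeff_neg_part coeff_sum)

lemma pos_plus_neg: "pos_part A + neg_part A = A"
  by (simp add: neg_part_def)

lemma pos_part_idem: "pos_part (pos_part A) = pos_part A"
  by (rule pdo_eqI) (simp add: coeff_pos_part)

lemma pos_part_fop: "pos_part (fop f) = fop f"
  by (rule pdo_eqI) (simp add: coeff_pos_part coeff_fop)

lemma pos_part_delta: "pos_part delta = delta"
  by (rule pdo_eqI) (simp add: coeff_pos_part coeff_Dpow)

lemma neg_part_pos: "pos_part A = A \<Longrightarrow> neg_part A = 0"
  by (simp add: neg_part_def)

lemma pos_part_times: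
  assumes "pos_part A = A" "pos_part B = B"
  shows "pos_part (A * B) = A * B"
proof (rule pdo_ker_eqI)
  fix n m
  obtain d e where d: "ord_le A d" "ord_le B e" using ord_le_ex by metis
  have A: "ker A n m = 0" if "m < n" for n m
    using ker_pos_part[of A n m] that assms(1) by simp
  have B: "ker B n m = 0" if "m < n" for n m
    using ker_pos_part[of B n m] that assms(2) by simp
  have "ker (A * B) n m = 0" if "m < n"
    unfolding ker_times[OF d]
  proof (rule sum.neutral, rule ballI)
    fix p
    show "ker A n p * ker B p m = 0"
      by (cases "p < n") (use that A B in auto)
  qed
  then show "ker (pos_part (A * B)) n m = ker (A * B) n m"
    by (simp add: ker_pos_part)
qed

text \<open>The adjoint acts by the transpose, so \<open>g\<close> is summed against column
  \<open>m\<close> of the matrix of \<open>\<Delta>^j\<close>.\<close>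

lemma diff_adjs_apply:
  fixes g :: "int \<Rightarrow> 'a::field_char_0"
  shows "(diff_adj ^^ j) g m = (\<Sum>n\<in>{m - int j..m}. g n * dker (int j) (m - n))"
proof (induction j arbitrary: m)
  case 0
  then show ?case by (simp add: dker_def)
next
  case (Suc j)
  \<comment> \<open>Coefficients in \<open>(\<Lambda> - I)^(j+1) = \<Lambda> (\<Lambda> - I)^j -
    (\<Lambda> - I)^j\<close>.\<close>
  have pascal: "dker (int (Suc j)) x = dker (int j) (x - 1) - (dker (int j) x :: 'a)" for x
  proof -
    consider "x > int j + 1" | "x = int j + 1" | "x \<le> int j" by linarith
    then show ?thesis
    proof cases
      case 3
      define s where "s = nat (int j - x)"
      have s: "nat (int (Suc j) - x) = Suc s" "nat (int j - (x - 1)) = Suc s" "nat (int j - x) = s"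
        using 3 by (simp_all add: s_def nat_diff_distrib' nat_add_distrib)
      have "(of_nat (Suc j) :: 'a) gchoose Suc s = (of_nat j gchoose s) + (of_nat j gchoose Suc s)"
        using gbinomial_Suc_Suc[of "of_nat j :: 'a" s] by (simp add: add.commute)
      then show ?thesis
        using 3 unfolding dker_def s by (simp add: algebra_simps)
    qed (auto simp: dker_def)
  qed
  have "(diff_adj ^^ Suc j) g m = (diff_adj ^^ j) g (m - 1) - (diff_adj ^^ j) g m"
    by (simp add: diff_adj_def)
  also have "\<dots> = (\<Sum>n\<in>{m - 1 - int j..m - 1}. g n * dker (int j) (m - 1 - n))
     - (\<Sum>n\<in>{m - int j..m}. g n * dker (int j) (m - n))"
    by (simp only: Suc.IH)
  also have "(\<Sum>n\<in>{m - 1 - int j..m - 1}. g n * dker (int j) (m - 1 - n))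
    = (\<Sum>n\<in>{m - int (Suc j)..m}. g n * dker (int j) (m - 1 - n))"
    by (rule sum.mono_neutral_left) (auto simp: dker_nonneg)
  also have "(\<Sum>n\<in>{m - int j..m}. g n * dker (int j) (m - n))
    = (\<Sum>n\<in>{m - int (Suc j)..m}. g n * dker (int j) (m - n))"
    by (rule sum.mono_neutral_left) (auto simp: dker_def)
  also have "(\<Sum>n\<in>{m - int (Suc j)..m}. g n * dker (int j) (m - 1 - n))
     - (\<Sum>n\<in>{m - int (Suc j)..m}. g n * dker (int j) (m - n))
     = (\<Sum>n\<in>{m - int (Suc j)..m}. g n * dker (int (Suc j)) (m - n))"
    unfolding sum_subtractf[symmetric] by (rule sum.cong) (simp_all only: pascal algebra_simps)
  finally show ?case .
qed

text \<open>A row vector times the upper triangle: \<open>n \<le> m\<close> selects the non-negative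
  part, and \<open>m - d\<close> is the edge of the band.\<close>

lemma adj_act_ker:
  assumes "ord_le A d"
  shows "adj_act (pos_part A) g m = (\<Sum>n\<in>{m-d..m}. g n * ker A n m)"
proof -
  have "adj_act (pos_part A) g m =
      (\<Sum>j | 0 \<le> j \<and> coeff (pos_part A) j \<noteq> 0. (diff_adj ^^ nat j) (coeff (pos_part A) j * g) m)"
    by (simp add: adj_act_def sum_fun_apply)
  also have "\<dots> = (\<Sum>j\<in>{0..d}. (diff_adj ^^ nat j) (coeff A j * g) m)"
  proof (rule sum.mono_neutral_cong_left)
    show "{j. 0 \<le> j \<and> coeff (pos_part A) j \<noteq> 0} \<subseteq> {0..d}"
      using assms by (auto simp: coeff_pos_part ord_le_def not_le[symmetric])
    have z: "(diff_adj ^^ i) 0 = (0 :: int \<Rightarrow> 'a)" for i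
      by (induction i) (simp_all add: diff_adj_def zero_fun_def)
    show "\<forall>i\<in>{0..d} - {j. 0 \<le> j \<and> coeff (pos_part A) j \<noteq> 0}. (diff_adj ^^ nat i) (coeff A i * g) m = 0"
      by (auto simp: coeff_pos_part z)
  qed (auto simp: coeff_pos_part)
  also have "\<dots> = (\<Sum>j\<in>{0..d}. \<Sum>n\<in>{m-d..m}. coeff A j n * g n * dker j (m - n))"
  proof (rule sum.cong[OF refl])
    fix j assume "j \<in> {0..d}"
    then show "(diff_adj ^^ nat j) (coeff A j * g) m = (\<Sum>n\<in>{m-d..m}. coeff A j n * g n * dker j (m - n))"
      unfolding diff_adjs_apply by (intro sum.mono_neutral_cong_left) (auto simp: dker_def)
  qed
  also have "\<dots> = (\<Sum>n\<in>{m-d..m}. \<Sum>j\<in>{0..d}. coeff A j n * g n * dker j (m - n))"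
    by (rule sum.swap)
  also have "\<dots> = (\<Sum>n\<in>{m-d..m}. g n * ker A n m)"
  proof (rule sum.cong[OF refl])
    fix n assume "n \<in> {m-d..m}"
    then have n: "0 \<le> m - n" by simp
    show "(\<Sum>j\<in>{0..d}. coeff A j n * g n * dker j (m - n)) = g n * ker A n m"
      by (simp only: ker_eq[OF assms n] sum_distrib_left mult.assoc mult.left_commute)
  qed
  finally show ?thesis .
qed

text \<open>Below the diagonal an entry of \<open>\<Delta>\<^sup>-\<^sup>1 b C\<close> is the sum of a whole column of \<open>b C\<close>, since
  \<open>C\<close> is upper triangular.\<close>

lemma neg_part_semisep_times:
  assumes "pos_part C = C"
  shows "neg_part (semisep a b * C) = semisep a (adj_act C b)"
proof (rule pdo_ker_eqI)
  fix n m
  obtain d where d: "ord_le C d" using ord_le_ex by blast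
  have C: "ker C n m = 0" if "m < n" for n m
    using ker_pos_part[of C n m] that assms by simp
  have "ker (semisep a b * C) n m = a n * adj_act C b m" if "m < n"
  proof -
    have "ker (semisep a b * C) n m = (\<Sum>p\<in>{m-d..n-1}. a n * (b p * ker C p m))"
      by (simp add: ker_times[OF ord_le_semisep d] ker_semisep mult.assoc)
    also have "\<dots> = (\<Sum>p\<in>{m-d..m}. a n * (b p * ker C p m))"
      using that by (intro sum.mono_neutral_right) (auto simp: C)
    also have "\<dots> = a n * adj_act C b m"
      using adj_act_ker[OF d, of b m] assms by (simp add: sum_distrib_left)
    finally show ?thesis .
  qed
  then show "ker (neg_part (semisep a b * C)) n m = ker (semisep a (adj_act C b)) n m"
    by (simp add: ker_neg_part ker_semisep)
qed

text \<open>Summation by parts: \<open>\<Delta>\<^sup>-\<^sup>1 (\<Delta> h) \<Delta>\<^sup>-\<^sup>1 = h \<Delta>\<^sup>-\<^sup>1 - \<Delta>\<^sup>-\<^sup>1 \<Lambda>(h)\<close> for every antidifference \<open>h\<close>.\<close>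

lemma semisep_times:
  assumes "diff h = b * c"
  shows "semisep a b * semisep c d = semisep (a * h) d - semisep a (shift 1 h * d)"
proof -
  have "antidelta * fop (b * c) * antidelta = antidelta * (delta * fop h - fop (shift 1 h) * delta) * antidelta"
    by (simp add: assms[symmetric] delta_fop)
  also have "\<dots> = fop h * antidelta - antidelta * fop (shift 1 h)"
    by (simp only: left_diff_distrib right_diff_distrib mult.assoc[symmetric] antidelta_delta mult_1_left)
       (simp only: mult.assoc delta_antidelta mult_1_right)
  finally have *: "antidelta * (fop b * fop c) * antidelta = fop h * antidelta - antidelta * fop (shift 1 h)"
    by (simp only: fop_mult)
  have "semisep a b * semisep c d = fop a * (antidelta * (fop b * fop c) * antidelta) * fop d"
    by (simp only: semisep_def mult.assoc)
  also have "\<dots> = semisep (a * h) d - semisep a (shift 1 h * d)"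
    unfolding * by (simp only: semisep_def mult.assoc left_diff_distrib right_diff_distrib fop_mult)
  finally show ?thesis .
qed

lemma delta_semisep: "delta * semisep a b = fop (shift 1 a * b) + semisep (diff a) b"
proof -
  have "delta * semisep a b = (delta * fop a) * antidelta * fop b"
    by (simp only: semisep_def mult.assoc)
  also have "\<dots> = fop (shift 1 a) * (delta * antidelta) * fop b + semisep (diff a) b"
    unfolding delta_fop by (simp only: semisep_def distrib_right mult.assoc)
  finally show ?thesis by (simp add: delta_antidelta fop_mult)
qed

lemma lax_semisep: "lax q r = delta + semisep q r"
  by (simp add: lax_def semisep_def)

lemma pdo_invI:
  fixes A B :: "'a::field_char_0 pdo"
  assumes "A * B = 1" "B * A = 1"
  shows "pdo_inv A = B"
  unfolding pdo_inv_def
proof (rule the_equality)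
  fix C assume "A * C = 1 \<and> C * A = 1"
  then have "C * (A * B) = B" by (simp add: mult.assoc[symmetric])
  then show "C = B" using assms by simp
qed (use assms in simp)

section \<open>Powers of the Lax operator\<close>

lemma pos_part_lax: "pos_part (lax q r) = delta"
  by (simp add: lax_semisep pos_part_add pos_part_delta pos_part_eq_0[OF ord_le_semisep])

lemma act_delta: "act delta f = diff f"
proof -
  have "{j. 0 \<le> j \<and> coeff delta j \<noteq> (0 :: int \<Rightarrow> 'a)} = {1}"
    by (auto simp: coeff_Dpow)
  then show ?thesis
    unfolding act_def by (simp add: coeff_Dpow)
qed

lemma adj_act_delta: "adj_act delta g = diff_adj g"
proof -
  have "{j. 0 \<le> j \<and> coeff delta j \<noteq> (0 :: int \<Rightarrow> 'a)} = {1}"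
    by (auto simp: coeff_Dpow)
  then show ?thesis
    unfolding adj_act_def by (simp add: coeff_Dpow)
qed

text \<open>\<open>upper_pow L Q R i\<close> turns out to be \<open>(L\<^sup>i)\<^sub>+\<close>; the recursion below is what remains of
  \<open>L\<^sup>i\<^sup>+\<^sup>1 = L L\<^sup>i\<close> once the negative part of \<open>L\<^sup>i\<close> is known to be \<open>\<Sum> Q\<^sub>a \<Delta>\<^sup>-\<^sup>1 R\<^sub>j\<close> over \<open>a + j = i - 1\<close>.\<close>

primrec upper_pow :: "'a::field_char_0 pdo \<Rightarrow> (nat \<Rightarrow> int \<Rightarrow> 'a) \<Rightarrow> (nat \<Rightarrow> int \<Rightarrow> 'a) \<Rightarrow> nat \<Rightarrow> 'a pdo" where
  "upper_pow L Q R 0 = 1"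
| "upper_pow L Q R (Suc i) = pos_part (L * upper_pow L Q R i)
     + (\<Sum>j<i. fop (shift 1 (Q (i - 1 - j)) * R j))"

lemma pos_part_upper_pow: "pos_part (upper_pow L Q R i) = upper_pow L Q R i"
  by (cases i) (simp_all add: one_eq_fop pos_part_fop pos_part_add pos_part_idem pos_part_sum)

lemma ord_le_add: "ord_le A d \<Longrightarrow> ord_le B d \<Longrightarrow> ord_le (A + B) d"
  by (simp add: ord_le_def coeff_add)

lemma ord_le_sum: "(\<And>i. i \<in> I \<Longrightarrow> ord_le (A i) d) \<Longrightarrow> ord_le (sum A I) d"
  by (simp add: ord_le_def coeff_sum)

lemma ord_le_pos_part: "ord_le A d \<Longrightarrow> ord_le (pos_part A) d"
  by (simp add: ord_le_def coeff_pos_part)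

lemma ord_le_lax: "ord_le (lax q r) 1"
  unfolding lax_semisep
  by (intro ord_le_add ord_le_Dpow ord_le_mono[OF ord_le_semisep]) simp

lemma ord_le_upper_pow: "ord_le (upper_pow (lax q r) Q R i) (int i)"
proof (induction i)
  case 0
  then show ?case by (simp add: one_eq_fop ord_le_fop)
next
  case (Suc i)
  show ?case
    unfolding upper_pow.simps
    by (intro ord_le_add ord_le_sum ord_le_pos_part ord_le_mono[OF ord_le_times[OF ord_le_lax Suc]]
        ord_le_mono[OF ord_le_fop]) auto
qed

lemma formal_action_laxD:
  assumes "formal_action (lax q r) q r Q R H"
  shows "Q 0 = q" "R 0 = r" "H i j (n + 1) = H i j n + Q i n * R j n"
    "Q (Suc i) = diff (Q i) + q * H i 0"
    "R (Suc j) = diff_adj (R j) - r * shift 1 (H 0 j)"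
    "H (Suc i) j - H i (Suc j) = Q i * shift (-1) (R j) + H i 0 * H 0 j"
    "diff (H i j) = Q i * R j"
proof -
  show d: "diff (H i j) = Q i * R j"
    using assms by (simp add: formal_action_def)
  show "H i j (n + 1) = H i j n + Q i n * R j n"
    using fun_cong[OF d, of n] by (simp add: diff_def algebra_simps)
qed (use assms in \<open>simp_all only: formal_action_def pos_part_lax act_delta adj_act_delta\<close>)

lemma fps_X_mult_nth_Suc: "fps_nth (fps_X * (f :: 'a::comm_ring_1 fps)) (Suc l) = fps_nth f l"
  by simp

text \<open>In generating functions \<open>Q(z) = \<Sum> z\<^sup>i Q\<^sub>i\<close> etc. the recursions of a formal action form a linear
  system of rank 2 and its dual; the left-hand side below is their Wronskian, and the rule
  \<open>\<Delta>\<^sup>-\<^sup>1(\<Delta> f) = f\<close> normalises it to 1.\<close>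

lemma wronskian:
  fixes Q R :: "nat \<Rightarrow> int \<Rightarrow> 'a::field_char_0"
  assumes "formal_action (lax q r) q r Q R H"
  shows "(1 + fps_X * Abs_fps (\<lambda>i. H i 0 n)) * (1 - fps_X * Abs_fps (\<lambda>j. H 0 j n))
     = 1 + fps_X * (fps_X * (Abs_fps (\<lambda>i. Q i n) * Abs_fps (\<lambda>j. R j (n - 1))))"
proof -
  let ?h = "Abs_fps (\<lambda>i. H i 0 n)" and ?g = "Abs_fps (\<lambda>j. H 0 j n)"
  let ?QR = "Abs_fps (\<lambda>i. Q i n) * Abs_fps (\<lambda>j. R j (n - 1))"
  \<comment> \<open>The last clause of \<open>formal_action\<close>, summed over an antidiagonal,
    telescopes to the difference of its two end values of \<open>H\<close>. The product of the two
    series then expands to the claim.\<close>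
  have "?h - ?g = fps_X * (?QR + ?h * ?g)"
  proof (rule fps_ext)
    fix i
    show "fps_nth (?h - ?g) i = fps_nth (fps_X * (?QR + ?h * ?g)) i"
    proof (cases i)
      case (Suc l)
      have "H (Suc a) (l - a) n - H a (Suc (l - a)) n = Q a n * R (l - a) (n - 1) + H a 0 n * H 0 (l - a) n" for a
        using fun_cong[OF formal_action_laxD(6)[OF assms, of a "l - a"], of n] by (simp add: shift_def)
      then have "(\<Sum>a=0..l. Q a n * R (l - a) (n - 1) + H a 0 n * H 0 (l - a) n)
         = (\<Sum>a=0..l. H (Suc a) (Suc l - Suc a) n - H a (Suc l - a) n)"
        by (intro sum.cong) (auto simp: Suc_diff_le)
      also have "\<dots> = H (Suc l) 0 n - H 0 (Suc l) n"
        using sum_Suc_diff[of 0 l "\<lambda>a. H a (Suc l - a) n"] by simp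
      finally show ?thesis
        unfolding Suc fps_X_mult_nth_Suc by (simp add: fps_mult_nth sum.distrib)
    qed simp
  qed
  then show ?thesis by algebra
qed

text \<open>For a fixed column \<open>m\<close>, the entries \<open>e\<close> of \<open>\<Sum> z\<^sup>i (L\<^sup>i)\<^sub>+\<close> and their partial sums \<open>F\<close> weighted
  with \<open>r\<close> solve the same system as \<open>z Q(z)\<close> and \<open>\<phi>\<close>, except at \<open>n = m\<close>.  Their Wronskian \<open>w\<close> with the dual
  solution is constant in \<open>n\<close> up to \<open>m\<close>, and it vanishes because its \<open>z\<^sup>i\<close>-coefficient does for \<open>n \<le> m - i\<close>.
  This fixes the summation constant.\<close>

lemma adj_act_upper_pow:
  fixes Q R :: "nat \<Rightarrow> int \<Rightarrow> 'a::field_char_0"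
  assumes act: "formal_action (lax q r) q r Q R H"
  shows "adj_act (upper_pow (lax q r) Q R i) r = R i + (\<Sum>j<i. shift 1 (H (i - 1 - j) 0) * R j)"
proof
  fix m
  note rel = formal_action_laxD[OF act]
  define E where "E = upper_pow (lax q r) Q R"
  have E0: "E 0 = 1" by (simp add: E_def)
  have oE: "ord_le (E i) (int i)" for i
    unfolding E_def by (rule ord_le_upper_pow)
  have E_0: "ker (E i) n m = 0" if "n < m - int i" for i n
    by (rule ker_eq_0[OF oE]) (use that in simp)
  define e where "e n = Abs_fps (\<lambda>i. ker (E i) n m)" for n
  \<comment> \<open>\<open>F\<close> starts at the band edge \<open>m - i\<close>, below which
    column \<open>m\<close> of \<open>E i\<close> vanishes. At \<open>n = m + 1\<close> it is the
    full column sum, that is, the adjoint action on \<open>r\<close> at \<open>m\<close>.\<close>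
  define F where "F n = Abs_fps (\<lambda>i. \<Sum>p\<in>{m - int i..n - 1}. r p * ker (E i) p m)" for n
  define qh where "qh n = Abs_fps (\<lambda>i. Q i n)" for n
  define rh where "rh n = Abs_fps (\<lambda>i. R i n)" for n
  define \<phi> where "\<phi> n = 1 + fps_X * Abs_fps (\<lambda>i. H i 0 n)" for n
  define \<psi> where "\<psi> n = 1 - fps_X * Abs_fps (\<lambda>j. H 0 j n)" for n
  define w where "w n = F n * \<psi> n - fps_X * e n * rh (n - 1)" for n
  have kE: "ker (E (Suc i)) n m = ker (E i) (n + 1) m - ker (E i) n m
      + q n * (\<Sum>p\<in>{m - int i..n - 1}. r p * ker (E i) p m)
      + (if n = m then \<Sum>j<i. Q (i - 1 - j) (m + 1) * R j m else 0)" if "n \<le> m" for i n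
  proof -
    have "ker (semisep q r * E i) n m = q n * (\<Sum>p\<in>{m - int i..n - 1}. r p * ker (E i) p m)"
      by (simp add: ker_times[OF ord_le_semisep oE] ker_semisep sum_distrib_left mult.assoc)
    moreover have "E (Suc i) = pos_part (delta * E i + semisep q r * E i)
        + (\<Sum>j<i. fop (shift 1 (Q (i - 1 - j)) * R j))"
      by (simp add: E_def lax_semisep distrib_right)
    ultimately show ?thesis
      using that by (auto simp: ker_add ker_pos_part ker_delta_times ker_sum ker_fop shift_def)
  qed
  have E_up: "ker (E i) n m = 0" if "m < n" for i n
    using ker_pos_part[of "E i" n m] that by (simp add: E_def pos_part_upper_pow)
  have F_step: "F (n + 1) = F n + fps_const (r n) * e n" for n
  proof (rule fps_ext)
    fix i
    have "{m - int i..n} = (if n < m - int i then {} else insert n {m - int i..n - 1})" by auto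
    then show "fps_nth (F (n + 1)) i = fps_nth (F n + fps_const (r n) * e n) i"
      by (simp add: F_def e_def E_0)
  qed
  have e_step: "e n = fps_X * (e (n + 1) - e n + fps_const (q n) * F n)" if "n < m" for n
  proof (rule fps_ext)
    fix i
    show "fps_nth (e n) i = fps_nth (fps_X * (e (n + 1) - e n + fps_const (q n) * F n)) i"
      using that by (cases i) (simp_all add: e_def F_def kE E0 ker_one)
  qed
  \<comment> \<open>On the diagonal \<open>e (m + 1)\<close> vanishes, and two sources appear: the
    entry of \<open>E 0 = 1\<close> and the functions added in \<open>upper_pow\<close>. Their sum
    is the Wronskian in \<open>wr\<close> below.\<close>
  have e_top: "e m = 1 + fps_X * (fps_const (q m) * F m - e m) + fps_X * (fps_X * (qh (m + 1) * rh m))"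
  proof (rule fps_ext)
    fix i
    consider "i = 0" | "i = 1" | l where "i = Suc (Suc l)" by (metis One_nat_def not0_implies_Suc)
    then show "fps_nth (e m) i =
        fps_nth (1 + fps_X * (fps_const (q m) * F m - e m) + fps_X * (fps_X * (qh (m + 1) * rh m))) i"
    proof cases
      case 1
      then show ?thesis by (simp add: e_def E0 ker_one)
    next
      case 2
      then show ?thesis using kE[of m 0] by (simp add: e_def F_def E_up)
    next
      case 3
      have "(\<Sum>j<Suc l. Q (Suc l - 1 - j) (m + 1) * R j m) = fps_nth (qh (m + 1) * rh m) l"
        unfolding mult.commute[of "qh (m + 1)"]
        by (simp add: fps_mult_nth qh_def rh_def lessThan_Suc_atMost atMost_atLeast0 mult.commute)
      then show ?thesis using 3 kE[of m "Suc l"] by (simp add: e_def F_def E_up)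
    qed
  qed
  have r_step: "rh n - fps_X * (rh (n - 1) - rh n) = fps_const (r n) * \<psi> (n + 1)" for n
  proof (rule fps_ext)
    fix i
    show "fps_nth (rh n - fps_X * (rh (n - 1) - rh n)) i = fps_nth (fps_const (r n) * \<psi> (n + 1)) i"
    proof (cases i)
      case (Suc j)
      then show ?thesis
        using fun_cong[OF rel(5)[of j], of n]
        by (simp add: rh_def \<psi>_def diff_adj_def shift_def algebra_simps)
    qed (simp add: rh_def \<psi>_def rel(2))
  qed
  have \<psi>_step: "\<psi> (n + 1) = \<psi> n - fps_X * fps_const (q n) * rh n" for n
  proof (rule fps_ext)
    fix i
    show "fps_nth (\<psi> (n + 1)) i = fps_nth (\<psi> n - fps_X * fps_const (q n) * rh n) i"
      by (cases i) (simp_all add: \<psi>_def rh_def rel(1,3) mult.assoc)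
  qed
  have w_step: "w (n + 1) = w n" if "n < m" for n
    using F_step[of n] e_step[OF that] r_step[of n] \<psi>_step[of n]
    unfolding w_def add_diff_cancel_right' by algebra
  have w_low: "fps_nth (w (m - int i)) i = 0" for i
  proof -
    have "fps_nth (F (m - int i)) a = 0" "fps_nth (fps_X * e (m - int i)) a = 0" if "a \<le> i" for a
      using that by (auto simp: F_def e_def intro!: E_0)
    then show ?thesis by (simp add: w_def fps_mult_nth)
  qed
  have w_m: "w m = 0"
  proof (rule fps_ext)
    fix i
    have "w (m - int l) = w m" for l
    proof (induction l)
      case (Suc l)
      then show ?case using w_step[of "m - int (Suc l)"] by simp
    qed simp
    then show "fps_nth (w m) i = fps_nth 0 i" using w_low[of i] by simp
  qed
  have wr: "\<phi> (m + 1) * \<psi> (m + 1) = 1 + fps_X * (fps_X * (qh (m + 1) * rh m))"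
    using wronskian[OF act, of "m + 1"] by (simp add: \<phi>_def \<psi>_def qh_def rh_def)
  \<comment> \<open>Starting from \<open>w m = 0\<close>, the step across the diagonal leaves
    \<open>rh m\<close> times the sources of \<open>e_top\<close>, which is \<open>rh m\<close>
    times \<open>\<phi> \<psi>\<close> by \<open>wr\<close>. The series \<open>\<psi>\<close> has
    constant term 1, so it cancels.\<close>
  have "F (m + 1) * \<psi> (m + 1) = rh m * \<phi> (m + 1) * \<psi> (m + 1)"
    using F_step[of m] e_top r_step[of m] \<psi>_step[of m] w_m wr
    unfolding w_def by algebra
  moreover have "fps_nth (\<psi> (m + 1)) 0 \<noteq> 0" by (simp add: \<psi>_def)
  then have "\<psi> (m + 1) \<noteq> 0" by auto
  ultimately have "F (m + 1) = rh m * \<phi> (m + 1)" by simp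
  then have "fps_nth (F (m + 1)) i = fps_nth (rh m * \<phi> (m + 1)) i" by simp
  also have "rh m * \<phi> (m + 1) = rh m + fps_X * (rh m * Abs_fps (\<lambda>i. H i 0 (m + 1)))"
    by (simp add: \<phi>_def algebra_simps)
  also have "fps_nth \<dots> i = R i m + (\<Sum>j<i. H (i - 1 - j) 0 (m + 1) * R j m)"
  proof (cases i)
    case (Suc l)
    then show ?thesis
      unfolding Suc fps_add_nth fps_X_mult_nth_Suc
      by (simp add: rh_def fps_mult_nth lessThan_Suc_atMost atMost_atLeast0 mult.commute)
  qed (simp add: rh_def)
  finally show "adj_act (upper_pow (lax q r) Q R i) r m = (R i + (\<Sum>j<i. shift 1 (H (i - 1 - j) 0) * R j)) m"
    using adj_act_ker[OF oE[of i], of r m]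
    by (simp add: F_def sum_fun_apply shift_def) (simp add: E_def pos_part_upper_pow)
qed

text \<open>In \<open>L L^i\<close>, the upper part of \<open>L^i\<close> contributes the negative
  part given by \<open>adj_act_upper_pow\<close>. Its terms with \<open>H\<close> cancel against
  those that summation by parts produces from the lower part of \<open>L^i\<close>, and the
  functions produced by \<Delta> enter \<open>upper_pow\<close>.\<close>

lemma lax_power:
  fixes Q R :: "nat \<Rightarrow> int \<Rightarrow> 'a::field_char_0"
  assumes act: "formal_action (lax q r) q r Q R H"
  shows "lax q r ^ i = upper_pow (lax q r) Q R i + (\<Sum>j<i. semisep (Q (i - 1 - j)) (R j))"
proof (induction i)
  case (Suc i)
  note rel = formal_action_laxD[OF act]
  let ?L = "lax q r" and ?E = "upper_pow (lax q r) Q R"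
  have LE: "?L * ?E i = pos_part (?L * ?E i) + semisep q (R i + (\<Sum>j<i. shift 1 (H (i - 1 - j) 0) * R j))"
  proof -
    have "neg_part (?L * ?E i) = neg_part (delta * ?E i) + neg_part (semisep q r * ?E i)"
      by (simp add: lax_semisep distrib_right neg_part_add)
    also have "neg_part (delta * ?E i) = 0"
      by (intro neg_part_pos pos_part_times pos_part_delta pos_part_upper_pow)
    also have "neg_part (semisep q r * ?E i) = semisep q (adj_act (?E i) r)"
      by (rule neg_part_semisep_times[OF pos_part_upper_pow])
    finally show ?thesis
      using pos_plus_neg[of "?L * ?E i"] by (simp add: adj_act_upper_pow[OF act])
  qed
  have LN: "?L * semisep (Q a) (R j) =
      fop (shift 1 (Q a) * R j) + semisep (Q (Suc a)) (R j) - semisep q (shift 1 (H a 0) * R j)" for a j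
  proof -
    have "diff (H a 0) = r * Q a" using rel(7)[of a 0] rel(2) by (simp add: mult.commute)
    then have "semisep q r * semisep (Q a) (R j) = semisep (q * H a 0) (R j) - semisep q (shift 1 (H a 0) * R j)"
      by (rule semisep_times)
    then show ?thesis
      by (simp add: lax_semisep distrib_right delta_semisep rel(4) semisep_add_left)
  qed
  have "?L ^ Suc i = ?L * ?E i + (\<Sum>j<i. ?L * semisep (Q (i - 1 - j)) (R j))"
    by (simp add: Suc.IH distrib_left sum_distrib_left)
  also have "\<dots> = ?E (Suc i) + (semisep q (R i) + (\<Sum>j<i. semisep (Q (Suc (i - 1 - j))) (R j)))"
    by (subst LE) (simp add: LN semisep_add_right semisep_sum_right sum.distrib sum_subtractf)
  also have "(\<Sum>j<i. semisep (Q (Suc (i - 1 - j))) (R j)) = (\<Sum>j<i. semisep (Q (Suc i - 1 - j)) (R j))"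
    by (intro sum.cong) (auto simp: Suc_diff_Suc)
  also have "semisep q (R i) + \<dots> = (\<Sum>j<Suc i. semisep (Q (Suc i - 1 - j)) (R j))"
    by (simp add: rel(1))
  finally show ?case .
qed simp

lemma neg_part_lax_power:
  fixes Q R :: "nat \<Rightarrow> int \<Rightarrow> 'a::field_char_0"
  assumes act: "formal_action (lax q r) q r Q R H"
  shows "neg_part (lax q r ^ i) = (\<Sum>j<i. semisep (Q (i - 1 - j)) (R j))"
  unfolding lax_power[OF act]
  by (simp add: neg_part_add neg_part_sum neg_part_pos[OF pos_part_upper_pow] neg_part_eq_self[OF ord_le_semisep])

text \<open>\<open>lax_power\<close> identifies \<open>upper_pow\<close> as the non-negative part of
  the power.\<close>

lemma adj_act_lax_power:
  fixes Q R :: "nat \<Rightarrow> int \<Rightarrow> 'a::field_char_0"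
  assumes act: "formal_action (lax q r) q r Q R H"
  shows "adj_act (pos_part (lax q r ^ i)) r = R i + (\<Sum>j<i. shift 1 (H (i - 1 - j) 0) * R j)"
  unfolding lax_power[OF act]
  by (simp add: pos_part_add pos_part_sum pos_part_upper_pow pos_part_eq_0[OF ord_le_semisep]
      adj_act_upper_pow[OF act])

section \<open>Conjugation by the gauge operator\<close>

lemma T_I_semisep: "T_I r = semisep (shift (-1) (recip r)) r"
  by (simp add: T_I_def semisep_def)

definition T_I_inv :: "(int \<Rightarrow> 'a::field_char_0) \<Rightarrow> 'a pdo" where
  "T_I_inv r = fop (recip r) * delta * fop (shift (-1) r)"

lemma pos_part_T_I_inv: "pos_part (T_I_inv r) = T_I_inv r"
  unfolding T_I_inv_def by (intro pos_part_times pos_part_fop pos_part_delta)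

lemma ord_le_T_I_inv: "ord_le (T_I_inv r) 1"
  using ord_le_times[OF ord_le_times[OF ord_le_fop ord_le_Dpow] ord_le_fop, of "recip r" 1 "shift (-1) r"]
  by (simp add: T_I_inv_def)

lemma recip_cancel:
  fixes r :: "int \<Rightarrow> 'a::field"
  assumes "\<forall>n. r n \<noteq> 0"
  shows "r * recip r = 1" "recip r * r = 1"
    "shift (-1) (recip r) * shift (-1) r = 1" "shift (-1) r * shift (-1) (recip r) = 1"
  using assms by (auto simp: fun_eq_iff recip_def shift_def)

lemma T_I_inverse:
  assumes nz: "\<forall>n. r n \<noteq> 0"
  shows "T_I r * T_I_inv r = 1" "T_I_inv r * T_I r = 1"
proof -
  have "T_I r * T_I_inv r = fop (shift (-1) (recip r)) * (antidelta * (fop r * fop (recip r)) * delta) * fop (shift (-1) r)"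
    by (simp only: T_I_def T_I_inv_def mult.assoc)
  also have "fop r * fop (recip r) = 1"
    by (simp add: fop_mult[symmetric] recip_cancel[OF nz] one_eq_fop[symmetric])
  finally show "T_I r * T_I_inv r = 1"
    by (simp add: antidelta_delta fop_mult[symmetric] recip_cancel[OF nz] one_eq_fop[symmetric])
  have "T_I_inv r * T_I r = fop (recip r) * (delta * (fop (shift (-1) r) * fop (shift (-1) (recip r))) * antidelta) * fop r"
    by (simp only: T_I_def T_I_inv_def mult.assoc)
  also have "fop (shift (-1) r) * fop (shift (-1) (recip r)) = 1"
    by (simp add: fop_mult[symmetric] recip_cancel[OF nz] one_eq_fop[symmetric])
  finally show "T_I_inv r * T_I r = 1"
    by (simp add: delta_antidelta fop_mult[symmetric] recip_cancel[OF nz] one_eq_fop[symmetric])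
qed

lemma pdo_inv_T_I: "\<forall>n. r n \<noteq> 0 \<Longrightarrow> pdo_inv (T_I r) = T_I_inv r"
  by (intro pdo_invI T_I_inverse)

lemma adj_inv_act_T_I:
  assumes "\<forall>n. r n \<noteq> 0"
  shows "adj_inv_act (T_I r) g = shift (-1) r * diff_adj (g * recip r)"
proof
  fix m
  have "adj_inv_act (T_I r) g m = adj_act (pos_part (T_I_inv r)) g m"
    by (simp add: adj_inv_act_def pdo_inv_T_I[OF assms] pos_part_T_I_inv)
  also have "\<dots> = (\<Sum>n\<in>{m - 1, m}. g n * ker (T_I_inv r) n m)"
    unfolding adj_act_ker[OF ord_le_T_I_inv] by (rule sum.cong) auto
  finally show "adj_inv_act (T_I r) g m = (shift (-1) r * diff_adj (g * recip r)) m"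
    by (simp add: T_I_inv_def ker_times_fop ker_fop_times ker_Dpow dker_1 diff_adj_def shift_def algebra_simps)
qed

lemma adj_inv_act_T_I_linear:
  assumes "\<forall>n. r n \<noteq> 0"
  shows "adj_inv_act (T_I r) (f + g) = adj_inv_act (T_I r) f + adj_inv_act (T_I r) g"
    "adj_inv_act (T_I r) (f - g) = adj_inv_act (T_I r) f - adj_inv_act (T_I r) g"
    "adj_inv_act (T_I r) (- g) = - adj_inv_act (T_I r) g"
    "adj_inv_act (T_I r) (\<lambda>n. c * g n) = (\<lambda>n. c * adj_inv_act (T_I r) g n)"
    "adj_inv_act (T_I r) (sum F I) = (\<Sum>i\<in>I. adj_inv_act (T_I r) (F i))"
  unfolding adj_inv_act_T_I[OF assms]
  by (auto simp: fun_eq_iff diff_adj_def shift_def sum_fun_apply sum_distrib_right sum_distrib_left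
      sum_subtractf algebra_simps)

text \<open>The adjoint of \<Delta> annihilates the constant \<open>r * recip r\<close>. This is why
  the term with index \<open>j = 0\<close> is lost under the transformation and the indices of
  \<open>R\<close> drop by one.\<close>

lemma adj_inv_act_T_I_self: "\<forall>n. r n \<noteq> 0 \<Longrightarrow> adj_inv_act (T_I r) r = 0"
  by (simp add: adj_inv_act_T_I recip_cancel diff_adj_def fun_eq_iff)

lemma semisep_T_I_inv:
  assumes nz: "\<forall>n. r n \<noteq> 0"
  shows "semisep a b * T_I_inv r = fop (a * shift (-1) b) + semisep a (adj_inv_act (T_I r) b)"
proof -
  have "semisep a b * T_I_inv r = fop a * (antidelta * (fop b * fop (recip r)) * delta) * fop (shift (-1) r)"
    by (simp only: semisep_def T_I_inv_def mult.assoc)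
  also have "\<dots> = fop (a * (shift (-1) (b * recip r) * shift (-1) r)) +
      semisep a (diff_adj (b * recip r) * shift (-1) r)"
    unfolding fop_mult[symmetric] antidelta_fop_delta
    by (simp only: semisep_def fop_mult distrib_left distrib_right mult.assoc)
  also have "shift (-1) (b * recip r) * shift (-1) r = shift (-1) b"
    using nz by (auto simp: fun_eq_iff shift_def recip_def)
  finally show ?thesis
    unfolding adj_inv_act_T_I[OF nz] by (simp only: mult.commute[of "diff_adj _"])
qed

lemma gauge_T_I: "\<forall>n. r n \<noteq> 0 \<Longrightarrow> gauge (T_I r) A = T_I r * A * T_I_inv r"
  by (simp add: gauge_def pdo_inv_T_I)

lemma gauge_T_I_add:
  "\<forall>n. r n \<noteq> 0 \<Longrightarrow> gauge (T_I r) (A + B) = gauge (T_I r) A + gauge (T_I r) B"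
  by (simp add: gauge_T_I distrib_left distrib_right)

lemma gauge_T_I_uminus:
  "\<forall>n. r n \<noteq> 0 \<Longrightarrow> gauge (T_I r) (- A) = - gauge (T_I r) A"
  by (simp add: gauge_T_I)

lemma gauge_T_I_sum:
  "\<forall>n. r n \<noteq> 0 \<Longrightarrow> gauge (T_I r) (sum A I) = (\<Sum>i\<in>I. gauge (T_I r) (A i))"
  by (simp add: gauge_T_I sum_distrib_left sum_distrib_right)

lemma gauge_T_I_times:
  assumes "\<forall>n. r n \<noteq> 0"
  shows "gauge (T_I r) (A * B) = gauge (T_I r) A * gauge (T_I r) B"
proof -
  have "gauge (T_I r) A * gauge (T_I r) B = T_I r * A * (T_I_inv r * T_I r) * B * T_I_inv r"
    by (simp only: gauge_T_I[OF assms] mult.assoc)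
  then show ?thesis by (simp add: T_I_inverse[OF assms] gauge_T_I[OF assms] mult.assoc)
qed

lemma gauge_T_I_power:
  assumes "\<forall>n. r n \<noteq> 0"
  shows "gauge (T_I r) (A ^ i) = gauge (T_I r) A ^ i"
proof (induction i)
  case 0
  show ?case by (simp add: gauge_T_I[OF assms] T_I_inverse[OF assms])
qed (simp add: gauge_T_I_times[OF assms])

lemma ord_le_gauge_T_I:
  assumes "\<forall>n. r n \<noteq> 0" "ord_le A d"
  shows "ord_le (gauge (T_I r) A) d"
  using ord_le_times[OF ord_le_times[OF ord_le_semisep assms(2)] ord_le_T_I_inv, of "shift (-1) (recip r)" r r]
  unfolding gauge_T_I[OF assms(1)] unfolding T_I_semisep by simp

text \<open>Summation by parts gives two semiseparable operators. Multiplying them by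
  \<open>T_I_inv r\<close> produces two functions, which cancel because \<open>\<Lambda>^-1\<close>
  undoes the shift of \<open>h\<close>.\<close>

lemma gauge_T_I_semisep:
  assumes nz: "\<forall>n. r n \<noteq> 0" and h: "diff h = r * a"
  shows "gauge (T_I r) (semisep a b) =
    semisep (shift (-1) (recip r) * h) (adj_inv_act (T_I r) b)
    - semisep (shift (-1) (recip r)) (adj_inv_act (T_I r) (shift 1 h * b))"
proof -
  have "gauge (T_I r) (semisep a b) = semisep (shift (-1) (recip r) * h) b * T_I_inv r
      - semisep (shift (-1) (recip r)) (shift 1 h * b) * T_I_inv r"
    unfolding gauge_T_I[OF nz] unfolding T_I_semisep
    by (simp only: semisep_times[OF h] left_diff_distrib)
  moreover have "shift (-1) (shift 1 h * b) = h * shift (-1) b"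
    by (simp add: shift_def fun_eq_iff)
  ultimately show ?thesis
    by (simp add: semisep_T_I_inv[OF nz] mult.assoc)
qed

text \<open>\<open>T_I_inv r\<close> is upper triangular, so only the negative part of
  \<open>T_I r * C\<close> matters; it is given by a column sum.\<close>

lemma neg_part_gauge_pos:
  assumes nz: "\<forall>n. r n \<noteq> 0" and C: "pos_part C = C"
  shows "neg_part (gauge (T_I r) C) = semisep (shift (-1) (recip r)) (adj_inv_act (T_I r) (adj_act C r))"
proof -
  let ?u = "shift (-1) (recip r)"
  have "T_I r * C = pos_part (T_I r * C) + semisep ?u (adj_act C r)"
    using pos_plus_neg[of "T_I r * C"] neg_part_semisep_times[OF C, of ?u r] by (simp add: T_I_semisep)
  then have "gauge (T_I r) C = pos_part (T_I r * C) * T_I_inv r + semisep ?u (adj_act C r) * T_I_inv r"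
    unfolding gauge_T_I[OF nz] by (metis distrib_right)
  then show ?thesis
    by (simp add: semisep_T_I_inv[OF nz] neg_part_add neg_part_eq_self[OF ord_le_semisep]
        neg_part_pos[OF pos_part_fop] neg_part_pos[OF pos_part_times[OF pos_part_idem pos_part_T_I_inv]])
qed

text \<open>Conjugation preserves negative order, the orders -1 of \<open>T_I r\<close> and 1 of its
  inverse cancelling.\<close>

lemma neg_part_gauge:
  assumes nz: "\<forall>n. r n \<noteq> 0"
  shows "neg_part (gauge (T_I r) A) =
    semisep (shift (-1) (recip r)) (adj_inv_act (T_I r) (adj_act (pos_part A) r)) + gauge (T_I r) (neg_part A)"
proof -
  have "neg_part (gauge (T_I r) A) = neg_part (gauge (T_I r) (pos_part A)) + neg_part (gauge (T_I r) (neg_part A))"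
    by (simp add: gauge_T_I_add[OF nz, symmetric] neg_part_add[symmetric] pos_plus_neg)
  then show ?thesis
    by (simp add: neg_part_gauge_pos[OF nz pos_part_idem]
        neg_part_eq_self[OF ord_le_gauge_T_I[OF nz ord_le_neg_part]])
qed

text \<open>The terms with \<open>H\<close> in \<open>adj_act_lax_power\<close> cancel against those
  from conjugating the negative part. The surviving \<open>R i\<close> supplies the summand
  \<open>j = i\<close>.\<close>

lemma neg_part_gauge_lax_power:
  assumes nz: "\<forall>n. r n \<noteq> 0" and act: "formal_action (lax q r) q r Q R H"
    and Qt: "Qt 0 = shift (-1) (recip r)" "\<And>i. Qt (Suc i) = shift (-1) (recip r) * H i 0"
  shows "neg_part (gauge (T_I r) (lax q r) ^ i) = (\<Sum>j\<le>i. semisep (Qt (i - j)) (adj_inv_act (T_I r) (R j)))"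
proof -
  note rel = formal_action_laxD[OF act]
  let ?\<tau> = "adj_inv_act (T_I r)"
  have "gauge (T_I r) (semisep (Q a) (R j)) =
      semisep (Qt (Suc a)) (?\<tau> (R j)) - semisep (Qt 0) (?\<tau> (shift 1 (H a 0) * R j))" for a j
    unfolding Qt by (rule gauge_T_I_semisep[OF nz]) (use rel(7)[of a 0] rel(2) in \<open>simp add: mult.commute\<close>)
  then have "neg_part (gauge (T_I r) (lax q r) ^ i) =
      semisep (Qt 0) (?\<tau> (R i)) + (\<Sum>j<i. semisep (Qt (Suc (i - 1 - j))) (?\<tau> (R j)))"
    by (simp add: gauge_T_I_power[OF nz, symmetric] neg_part_gauge[OF nz] adj_act_lax_power[OF act]
        neg_part_lax_power[OF act] gauge_T_I_sum[OF nz] adj_inv_act_T_I_linear[OF nz] Qt(1)[symmetric]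
        semisep_add_right semisep_sum_right sum_subtractf)
  also have "(\<Sum>j<i. semisep (Qt (Suc (i - 1 - j))) (?\<tau> (R j))) = (\<Sum>j<i. semisep (Qt (i - j)) (?\<tau> (R j)))"
    by (intro sum.cong) (auto simp: Suc_diff_Suc)
  also have "semisep (Qt 0) (?\<tau> (R i)) + \<dots> = (\<Sum>j\<le>i. semisep (Qt (i - j)) (?\<tau> (R j)))"
    by (simp add: lessThan_Suc_atMost[symmetric])
  finally show ?thesis .
qed

text \<open>Of the two summands for \<open>i = 1\<close>, the one with \<open>j = 0\<close> vanishes
  by \<open>adj_inv_act_T_I_self\<close>; a single one remains, as in the constrained form.\<close>

lemma neg_part_gauge_lax:
  assumes nz: "\<forall>n. r n \<noteq> 0" and act: "formal_action (lax q r) q r Q R H"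
    and Qt: "Qt 0 = shift (-1) (recip r)" "\<And>i. Qt (Suc i) = shift (-1) (recip r) * H i 0"
  shows "neg_part (gauge (T_I r) (lax q r)) = semisep (shift (-1) (recip r)) (adj_inv_act (T_I r) (R 1))"
  using neg_part_gauge_lax_power[OF nz act Qt, of 1]
  by (simp add: adj_inv_act_T_I_self[OF nz] formal_action_laxD(2)[OF act] semisep_zero Qt(1))

text \<open>The extra summand on the left completes the range to \<open>Suc n\<close>. Since
  \<open>f 0 = 0\<close>, the index can be shifted, which raises each weight by 1.\<close>

lemma weighted_sum_shift:
  fixes f :: "nat \<Rightarrow> 'a::field_char_0"
  assumes "f 0 = 0"
  shows "(\<Sum>j\<le>n. (of_nat j - c) * f j) + (of_nat (Suc n) - c) * f (Suc n)
    = (\<Sum>j\<le>n. (of_nat j - c) * f (Suc j)) + (\<Sum>j\<le>Suc n. f j)"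
proof -
  have "(\<Sum>j\<le>n. (of_nat j - c) * f j) + (of_nat (Suc n) - c) * f (Suc n) = (\<Sum>j\<le>Suc n. (of_nat j - c) * f j)"
    by simp
  also have "\<dots> = (\<Sum>j\<le>n. (of_nat (Suc j) - c) * f (Suc j))"
    by (subst sum.atMost_Suc_shift) (simp add: assms)
  also have "\<dots> = (\<Sum>j\<le>n. (of_nat j - c) * f (Suc j)) + (\<Sum>j\<le>n. f (Suc j))"
    by (simp add: sum.distrib[symmetric] algebra_simps)
  also have "(\<Sum>j\<le>n. f (Suc j)) = (\<Sum>j\<le>Suc n. f j)"
    by (subst sum.atMost_Suc_shift) (simp add: assms)
  finally show ?thesis .
qed

text \<open>The adjoint action of \<open>Xop\<close> on \<open>r\<close> cancels the corrections
  from \<open>gauge_T_I_semisep\<close>, and the term with \<open>R (k - 1)\<close> is the extra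
  summand in \<open>weighted_sum_shift\<close>. The raised weights leave the negative part of a
  power.\<close>

lemma gauge_Xop:
  assumes nz: "\<forall>n. r n \<noteq> 0" and act: "formal_action (lax q r) q r Q R H"
    and Qt: "Qt 0 = shift (-1) (recip r)" "\<And>i. Qt (Suc i) = shift (-1) (recip r) * H i 0"
    and Rt: "\<And>j. Rt j = adj_inv_act (T_I r) (R (Suc j))"
    and k: "k \<ge> 2"
  shows "gauge (T_I r) (Xop k Q R) + semisep (shift (-1) (recip r))
      (adj_inv_act (T_I r) ((\<lambda>n. of_nat k / 2 * R (k - 1) n) - Xadj_act k R H))
    = Xop k Qt Rt + neg_part (gauge (T_I r) (lax q r) ^ (k - 1))"
proof -
  note rel = formal_action_laxD[OF act]
  let ?\<tau> = "adj_inv_act (T_I r)"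
  obtain l where l: "k = l + 2" using k by (metis add.commute le_Suc_ex)
  define c :: "nat \<Rightarrow> 'a" where "c j = of_nat j - of_nat l / 2" for j
  have "diff (\<lambda>n. c j * H (l - j) 0 n) = r * (\<lambda>n. c j * Q (l - j) n)" for j
  proof
    fix n
    show "diff (\<lambda>n. c j * H (l - j) 0 n) n = (r * (\<lambda>n. c j * Q (l - j) n)) n"
      using fun_cong[OF rel(7)[of "l - j" 0], of n] rel(2)
      by (simp add: diff_def algebra_simps)
  qed
  note g = gauge_T_I_semisep[OF nz this]
  define hR where "hR j = shift 1 (H (l - j) 0) * R j" for j
  have X: "gauge (T_I r) (Xop k Q R) =
      (\<Sum>j\<le>l. semisep (\<lambda>n. c j * Qt (Suc (l - j)) n) (?\<tau> (R j))
         - semisep (Qt 0) (\<lambda>n. c j * ?\<tau> (hR j) n))"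
  proof -
    have 1: "Qt 0 * (\<lambda>n. c j * H (l - j) 0 n) = (\<lambda>n. c j * Qt (Suc (l - j)) n)" for j
      by (simp add: Qt fun_eq_iff)
    have "shift 1 (\<lambda>n. c j * H (l - j) 0 n) * R j = (\<lambda>n. c j * hR j n)" for j
      by (simp add: hR_def shift_def fun_eq_iff)
    then have 2: "?\<tau> (shift 1 (\<lambda>n. c j * H (l - j) 0 n) * R j) = (\<lambda>n. c j * ?\<tau> (hR j) n)" for j
      by (simp only: adj_inv_act_T_I_linear(4)[OF nz])
    have "Xop k Q R = (\<Sum>j\<le>l. semisep (\<lambda>n. c j * Q (l - j) n) (R j))"
      by (simp add: Xop_def l c_def Xcoef_def semisep_def)
    then show ?thesis
      by (simp only: gauge_T_I_sum[OF nz] g 1 2 Qt(1)[symmetric])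
  qed
  have Xadj: "Xadj_act k R H = - (\<Sum>j\<le>l. (\<lambda>n. c j * (hR j) n))"
    by (simp add: hR_def Xadj_act_def l c_def Xcoef_def fun_eq_iff sum_fun_apply sum_negf mult_ac)
  \<comment> \<open>So \<open>k / 2\<close> continues the coefficients \<open>c j\<close> to
    \<open>j = Suc l\<close>.\<close>
  have ck: "of_nat k / 2 = of_nat (Suc l) - (of_nat l / 2 :: 'a)"
    by (simp add: l field_simps)
  have V: "?\<tau> ((\<lambda>n. of_nat k / 2 * R (k - 1) n) - Xadj_act k R H) =
      (\<lambda>n. (of_nat (Suc l) - of_nat l / 2) * ?\<tau> (R (Suc l)) n)
      + (\<Sum>j\<le>l. (\<lambda>n. c j * ?\<tau> (hR j) n))"
    unfolding Xadj ck by (simp add: adj_inv_act_T_I_linear[OF nz] l del: of_nat_Suc)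
  have Xt: "Xop k Qt Rt = (\<Sum>j\<le>l. semisep (\<lambda>n. c j * Qt (l - j) n) (?\<tau> (R (Suc j))))"
    by (simp add: Xop_def l c_def Xcoef_def semisep_def Rt)
  have N: "neg_part (gauge (T_I r) (lax q r) ^ (k - 1)) = (\<Sum>j\<le>Suc l. semisep (Qt (Suc l - j)) (?\<tau> (R j)))"
    using neg_part_gauge_lax_power[OF nz act Qt, of "Suc l"] l by simp
  show ?thesis
  proof (rule pdo_ker_eqI)
    fix x y
    define f where "f j = Qt (Suc l - j) x * ?\<tau> (R j) y" for j
    have f0: "f 0 = 0"
      by (simp add: f_def rel(2) adj_inv_act_T_I_self[OF nz])
    have "(\<Sum>j\<le>l. c j * f j) + (of_nat (Suc l) - of_nat l / 2) * f (Suc l)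
       = (\<Sum>j\<le>l. c j * f (Suc j)) + (\<Sum>j\<le>Suc l. f j)"
      unfolding c_def by (rule weighted_sum_shift[of f, OF f0])
    moreover have "(\<Sum>j\<le>l. c j * f j) = (\<Sum>j\<le>l. c j * Qt (Suc (l - j)) x * ?\<tau> (R j) y)"
      by (rule sum.cong) (simp_all add: f_def Suc_diff_le)
    ultimately show "ker (gauge (T_I r) (Xop k Q R) + semisep (shift (-1) (recip r))
        (?\<tau> ((\<lambda>n. of_nat k / 2 * R (k - 1) n) - Xadj_act k R H))) x y
      = ker (Xop k Qt Rt + neg_part (gauge (T_I r) (lax q r) ^ (k - 1))) x y"
      unfolding X V Xt N
      by (simp add: ker_add ker_sum ker_diff ker_semisep sum_fun_apply sum_subtractf sum_distrib_left
          Qt(1)[symmetric] distrib_left mult_ac f_def del: of_nat_Suc sum.atMost_Suc)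
  qed
qed

section \<open>Derivatives of families of operators\<close>

lemma has_fun_deriv_shift: "has_fun_deriv F F' \<Longrightarrow> has_fun_deriv (\<lambda>x. shift k (F x)) (shift k F')"
  by (simp add: has_fun_deriv_def shift_def)

lemma has_fun_deriv_diff: "has_fun_deriv F F' \<Longrightarrow> has_fun_deriv (\<lambda>x. diff (F x)) (diff F')"
  by (auto simp: has_fun_deriv_def diff_def intro!: has_vector_derivative_diff)

lemma has_fun_deriv_diffs:
  "has_fun_deriv F F' \<Longrightarrow> has_fun_deriv (\<lambda>x. (diff ^^ i) (F x)) ((diff ^^ i) F')"
  by (induction i) (simp_all add: has_fun_deriv_diff)

lemma has_fun_deriv_recip:
  assumes "has_fun_deriv F F'" "\<forall>n. F 0 n \<noteq> 0"
  shows "has_fun_deriv (\<lambda>x. recip (F x)) (- (recip (F 0) * F' * recip (F 0)))"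
  unfolding has_fun_deriv_def
proof
  fix n
  have "((\<lambda>x. F x n) has_derivative (\<lambda>h. h *\<^sub>R F' n)) (at 0)"
    using assms(1) by (simp add: has_fun_deriv_def has_vector_derivative_def)
  from Deriv.has_derivative_inverse[OF _ this] assms(2)
  have "((\<lambda>x. inverse (F x n)) has_derivative (\<lambda>h. - (inverse (F 0 n) * (h *\<^sub>R F' n) * inverse (F 0 n)))) (at 0)"
    by simp
  then show "((\<lambda>x. recip (F x) n) has_vector_derivative (- (recip (F 0) * F' * recip (F 0))) n) (at 0)"
    by (simp add: has_vector_derivative_def recip_def)
qed

lemma has_op_deriv_ord:
  "has_op_deriv A A' \<longleftrightarrow> (\<exists>d. \<forall>\<^sub>F x in nhds 0. ord_le (A x) d) \<and>
     (\<forall>j. has_fun_deriv (\<lambda>x. coeff (A x) j) (coeff A' j))"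
  by (simp add: has_op_deriv_def ord_le_def has_fun_deriv_def)

lemma has_op_deriv_unique:
  assumes "has_op_deriv A A'" "has_op_deriv A A''"
  shows "A' = A''"
proof (rule pdo_eqI, rule ext)
  fix j n
  show "coeff A' j n = coeff A'' j n"
    using assms unfolding has_op_deriv_def by (meson vector_derivative_unique_at)
qed

text \<open>Agreement near 0 suffices, which matters because \<open>r\<close> is invertible only
  there.\<close>

lemma has_op_deriv_cong:
  assumes "\<forall>\<^sub>F x in nhds 0. A x = B x" "has_op_deriv A A'"
  shows "has_op_deriv B A'"
  unfolding has_op_deriv_ord has_fun_deriv_def
proof (intro conjI allI)
  obtain d where "\<forall>\<^sub>F x in nhds 0. ord_le (A x) d"
    using assms(2) by (auto simp: has_op_deriv_ord)
  then have "\<forall>\<^sub>F x in nhds 0. ord_le (B x) d"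
    using assms(1) by eventually_elim simp
  then show "\<exists>d. \<forall>\<^sub>F x in nhds 0. ord_le (B x) d" ..
  fix j n
  have "((\<lambda>x. coeff (A x) j n) has_vector_derivative coeff A' j n) (at 0)"
    using assms(2) by (simp add: has_op_deriv_def)
  moreover have "\<forall>\<^sub>F x in nhds 0. x \<in> UNIV \<longrightarrow> coeff (A x) j n = coeff (B x) j n"
    using assms(1) by eventually_elim simp
  moreover have "A 0 = B 0" using assms(1) by (rule eventually_nhds_x_imp_x)
  ultimately show "((\<lambda>x. coeff (B x) j n) has_vector_derivative coeff A' j n) (at 0)"
    using has_vector_derivative_cong_ev[where f = "\<lambda>x. coeff (A x) j n" and g = "\<lambda>x. coeff (B x) j n" and S = UNIV and x = 0] by simp
qed

lemma has_op_deriv_const: "has_op_deriv (\<lambda>x. A) 0"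
  using ord_le_ex[of A] by (simp add: has_op_deriv_ord has_fun_deriv_def coeff_zero)

lemma has_op_deriv_fop: "has_fun_deriv F F' \<Longrightarrow> has_op_deriv (\<lambda>x. fop (F x)) (fop F')"
  by (auto simp: has_op_deriv_def coeff_fop has_fun_deriv_def intro!: exI[of _ 0])

text \<open>Order bounds common to all parameters near 0 turn each coefficient of the product into
  one fixed finite sum.\<close>

lemma has_op_deriv_times:
  assumes A: "has_op_deriv A A'" and B: "has_op_deriv B B'"
  shows "has_op_deriv (\<lambda>x. A x * B x) (A' * B 0 + A 0 * B')"
proof -
  obtain d1 e1 where "\<forall>\<^sub>F x in nhds 0. ord_le (A x) d1" "\<forall>\<^sub>F x in nhds 0. ord_le (B x) e1"
    using A B by (auto simp: has_op_deriv_ord)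
  then have ev1: "\<forall>\<^sub>F x in nhds 0. ord_le (A x) d1 \<and> ord_le (B x) e1"
    by (rule eventually_conj)
  obtain d2 e2 where d2: "ord_le A' d2" "ord_le B' e2" using ord_le_ex by metis
  define d where "d = max d1 d2"
  define e where "e = max e1 e2"
  have ev: "\<forall>\<^sub>F x in nhds 0. ord_le (A x) d \<and> ord_le (B x) e"
    using ev1 by eventually_elim (auto simp: d_def e_def intro: ord_le_mono)
  have o': "ord_le A' d" "ord_le B' e"
    using d2 by (auto simp: d_def e_def intro: ord_le_mono)
  have o0: "ord_le (A 0) d" "ord_le (B 0) e"
    using ev by (auto dest: eventually_nhds_x_imp_x)
  have "\<forall>\<^sub>F x in nhds 0. ord_le (A x * B x) (d + e)"
    using ev by eventually_elim (simp add: ord_le_times)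
  moreover have "has_fun_deriv (\<lambda>x. coeff (A x * B x) k) (coeff (A' * B 0 + A 0 * B') k)" for k
    unfolding has_fun_deriv_def
  proof
    fix n
    define g where "g X Y = (\<Sum>j\<in>{k-e..d}. \<Sum>l\<in>{k-d..e}. if k \<le> j + l
       then (of_int j gchoose nat (j+l-k)) * coeff X j n * (diff ^^ nat (j+l-k)) (coeff Y l) (n + k - l)
       else 0)" for X Y :: "'a pdo"
    have g: "coeff (X * Y) k n = g X Y" if "ord_le X d" "ord_le Y e" for X Y
      unfolding g_def by (rule coeff_times[OF that order.refl])
    have a: "((\<lambda>x. coeff (A x) j n) has_vector_derivative coeff A' j n) (at 0)" for j
      using A by (simp add: has_op_deriv_def)
    have b: "((\<lambda>x. (diff ^^ i) (coeff (B x) l) y) has_vector_derivative (diff ^^ i) (coeff B' l) y) (at 0)" for i l y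
      using B has_fun_deriv_diffs[of "\<lambda>x. coeff (B x) l" "coeff B' l" i]
      by (simp add: has_op_deriv_ord has_fun_deriv_def)
    have "((\<lambda>x. if k \<le> j + l
       then (of_int j gchoose nat (j+l-k)) * coeff (A x) j n * (diff ^^ nat (j+l-k)) (coeff (B x) l) (n + k - l)
       else 0) has_vector_derivative
       (if k \<le> j + l
       then (of_int j gchoose nat (j+l-k)) * coeff A' j n * (diff ^^ nat (j+l-k)) (coeff (B 0) l) (n + k - l)
       else 0) +
       (if k \<le> j + l
       then (of_int j gchoose nat (j+l-k)) * coeff (A 0) j n * (diff ^^ nat (j+l-k)) (coeff B' l) (n + k - l)
       else 0)) (at 0)" for j l
      using has_vector_derivative_mult[OF has_vector_derivative_mult_right[OF a[of j], of "of_int j gchoose nat (j+l-k)"]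
          b[of "nat (j+l-k)" l "n + k - l"]]
      by (auto simp: add.commute)
    then have "((\<lambda>x. g (A x) (B x)) has_vector_derivative g A' (B 0) + g (A 0) B') (at 0)"
      unfolding g_def sum.distrib[symmetric] by (intro has_vector_derivative_sum)
    moreover have "\<forall>\<^sub>F x in nhds 0. x \<in> UNIV \<longrightarrow> coeff (A x * B x) k n = g (A x) (B x)"
      using ev by eventually_elim (simp add: g)
    ultimately show "((\<lambda>x. coeff (A x * B x) k n) has_vector_derivative coeff (A' * B 0 + A 0 * B') k n) (at 0)"
      using has_vector_derivative_cong_ev[where f = "\<lambda>x. coeff (A x * B x) k n" and g = "\<lambda>x. g (A x) (B x)" and S = UNIV and x = 0]
      by (simp add: coeff_add g[OF o'(1) o0(2)] g[OF o0(1) o'(2)] g[OF o0])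
  qed
  ultimately show ?thesis
    unfolding has_op_deriv_ord by blast
qed

text \<open>Differentiating \<open>T L T^-1\<close> adds \<open>T' T^-1\<close> to the conjugated
  generator, and this is one semiseparable operator depending on \<open>r'\<close>. The parameter
  may be a time or the additional time.\<close>

lemma has_op_deriv_gauge:
  assumes L: "has_op_deriv L (commutator P (L 0))" and r: "has_fun_deriv r r'"
    and ev: "\<forall>\<^sub>F s in nhds 0. \<forall>n. r s n \<noteq> 0"
  shows "has_op_deriv (\<lambda>s. gauge (T_I (r s)) (L s))
    (commutator (semisep (shift (-1) (recip (r 0))) (adj_inv_act (T_I (r 0)) r') + gauge (T_I (r 0)) P)
      (gauge (T_I (r 0)) (L 0)))"
proof -
  have nz: "\<forall>n. r 0 n \<noteq> 0"
    using ev by (rule eventually_nhds_x_imp_x)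
  define T where "T s = T_I (r s)" for s
  define S where "S s = T_I_inv (r s)" for s
  define u where "u s = shift (-1) (recip (r s))" for s
  define u' where "u' = shift (-1) (- (recip (r 0) * r' * recip (r 0)))"
  have TS: "T 0 * S 0 = 1" "S 0 * T 0 = 1"
    by (simp_all add: T_def S_def T_I_inverse[OF nz])
  have du: "has_fun_deriv u u'"
    unfolding u_def u'_def by (intro has_fun_deriv_shift has_fun_deriv_recip r nz)
  have "has_op_deriv (\<lambda>s. fop (u s) * antidelta * fop (r s))
      ((fop u' * antidelta + fop (u 0) * 0) * fop (r 0) + fop (u 0) * antidelta * fop r')"
    by (intro has_op_deriv_times has_op_deriv_fop du r has_op_deriv_const)
  then have dT: "has_op_deriv T (semisep u' (r 0) + semisep (u 0) r')"
    by (simp add: T_def[abs_def] u_def T_I_def semisep_def)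
  define T' where "T' = semisep u' (r 0) + semisep (u 0) r'"
  \<comment> \<open>Existence is enough: the value of \<open>S'\<close> follows by differentiating
    \<open>T S = 1\<close>.\<close>
  have "\<exists>S'. has_op_deriv S S'"
    unfolding S_def T_I_inv_def
    using has_op_deriv_times[OF has_op_deriv_times[OF has_op_deriv_fop[OF has_fun_deriv_recip[OF r nz]]
      has_op_deriv_const] has_op_deriv_fop[OF has_fun_deriv_shift[OF r]]] by blast
  then obtain S' where dS: "has_op_deriv S S'" by blast
  have "has_op_deriv (\<lambda>s. T s * S s) (T' * S 0 + T 0 * S')"
    using has_op_deriv_times[OF dT dS] by (simp add: T'_def)
  moreover have "has_op_deriv (\<lambda>s. T s * S s) 0"
    by (rule has_op_deriv_cong[OF _ has_op_deriv_const[of 1]])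
       (use ev in \<open>eventually_elim, simp add: T_def S_def T_I_inverse\<close>)
  ultimately have "T' * S 0 + T 0 * S' = 0" by (rule has_op_deriv_unique)
  then have "S 0 * (T' * S 0 + T 0 * S') = 0" by simp
  then have S': "S' = - (S 0 * T' * S 0)"
    by (simp add: distrib_left mult.assoc[symmetric] TS eq_neg_iff_add_eq_0 add.commute)
  \<comment> \<open>The functions split off by \<open>semisep_T_I_inv\<close> add up to the
    derivative of the constant \<open>\<Lambda>^-1(r^-1) \<Lambda>^-1(r) = 1\<close>, and the term
    with \<open>u'\<close> vanishes by \<open>adj_inv_act_T_I_self\<close>.\<close>
  have V: "T' * S 0 = semisep (u 0) (adj_inv_act (T_I (r 0)) r')"
  proof -
    have "u' * shift (-1) (r 0) + u 0 * shift (-1) r' = 0"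
      using nz by (simp add: u'_def u_def shift_def recip_def fun_eq_iff field_simps)
    then have "fop (u' * shift (-1) (r 0)) + fop (u 0 * shift (-1) r') = fop 0"
      by (simp only: fop_add[symmetric])
    also have "fop 0 = (0 :: 'a pdo)" by (rule pdo_eqI) (simp add: coeff_fop coeff_zero)
    finally show ?thesis
      by (simp add: T'_def S_def distrib_right semisep_T_I_inv[OF nz] adj_inv_act_T_I_self[OF nz] semisep_zero
          add.assoc[symmetric])
  qed
  have dLt: "has_op_deriv (\<lambda>s. T s * L s * S s)
      ((T' * L 0 + T 0 * commutator P (L 0)) * S 0 + T 0 * L 0 * S')"
    unfolding T'_def by (intro has_op_deriv_times dT dS L)
  have "(T' * L 0 + T 0 * commutator P (L 0)) * S 0 + T 0 * L 0 * S' =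
      commutator (T' * S 0 + T 0 * P * S 0) (T 0 * L 0 * S 0)"
  proof -
    have cancel: "T 0 * (S 0 * Z) = Z" "S 0 * (T 0 * Z) = Z" for Z
      by (simp_all add: mult.assoc[symmetric] TS)
    show ?thesis
      unfolding S' commutator_def
      by (simp add: algebra_simps cancel)
  qed
  then have "has_op_deriv (\<lambda>s. T s * L s * S s)
      (commutator (semisep (u 0) (adj_inv_act (T_I (r 0)) r') + gauge (T_I (r 0)) P) (gauge (T_I (r 0)) (L 0)))"
    using dLt V by (simp add: gauge_T_I[OF nz] T_def S_def)
  moreover have "\<forall>\<^sub>F s in nhds 0. T s * L s * S s = gauge (T_I (r s)) (L s)"
    using ev by eventually_elim (simp add: gauge_T_I T_def S_def)
  ultimately show ?thesis
    unfolding u_def by (rule has_op_deriv_cong[rotated])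
qed

section \<open>The transformed hierarchy and its additional flow\<close>

lemma commutator_pos_part_power: "commutator (pos_part (A ^ i)) A = - commutator (neg_part (A ^ i)) A"
proof -
  have "commutator (pos_part (A ^ i)) A + commutator (neg_part (A ^ i)) A = commutator (A ^ i) A"
    unfolding commutator_def by (subst (5 6) pos_plus_neg[symmetric]) (simp add: algebra_simps)
  also have "\<dots> = 0" by (simp add: commutator_def power_commutes)
  finally show ?thesis by (simp add: eq_neg_iff_add_eq_0)
qed

theorem theorem5p3:
  fixes U :: "times set"
    and q r :: "times \<Rightarrow> real \<Rightarrow> int \<Rightarrow> 'a::real_normed_field"
    and L :: "times \<Rightarrow> real \<Rightarrow> 'a pdo"
    and W :: "times \<Rightarrow> 'a pdo"
    and Q R Qt Rt :: "times \<Rightarrow> nat \<Rightarrow> int \<Rightarrow> 'a"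
    and H Ht :: "times \<Rightarrow> nat \<Rightarrow> nat \<Rightarrow> int \<Rightarrow> 'a"
    and M X Mt Xt :: "times \<Rightarrow> 'a pdo"
    and T Lt :: "times \<Rightarrow> real \<Rightarrow> 'a pdo"
    and qt rt :: "times \<Rightarrow> int \<Rightarrow> 'a"
    and k :: nat and t :: times
  assumes k: "k \<ge> 2"
    and M: "\<And>t. M t = Orlov_Schulman k (W t) t"
    and X: "\<And>t. X t = Xop k (Q t) (R t)"
    and T: "\<And>t s. T t s = T_I (r t s)"
    and Lt: "\<And>t s. Lt t s = gauge (T t s) (L t s)"
    and Mt: "\<And>t. Mt t = gauge (T t 0) (M t)"
    and qt: "\<And>t. qt t = shift (-1) (recip (r t 0))"
    and rt: "\<And>t. rt t = adj_inv_act (T t 0) (R t 1)"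
    and Xt: "\<And>t. Xt t = Xop k (Qt t) (Rt t)"
    and hierarchy: "cdKP U (\<lambda>t. L t 0) (\<lambda>t. q t 0) (\<lambda>t. r t 0)"
    and W: "dressing U (\<lambda>t. L t 0) W"
    and r_nonzero: "\<And>t. t \<in> U \<Longrightarrow> \<forall>\<^sub>F s in nhds 0. \<forall>n. r t s n \<noteq> 0"
    and action: "\<And>t. t \<in> U \<Longrightarrow> formal_action (L t 0) (q t 0) (r t 0) (Q t) (R t) (H t)"
    and action_t: "\<And>t. t \<in> U \<Longrightarrow> formal_action (Lt t 0) (qt t) (rt t) (Qt t) (Rt t) (Ht t)"
    and const_Q: "\<And>t i. t \<in> U \<Longrightarrow> Qt t (Suc i) = T_I_act (r t 0) (H t i 0)"
    and const_R: "\<And>t j. t \<in> U \<Longrightarrow> Rt t j = adj_inv_act (T t 0) (R t (Suc j))"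
    and flow_L: "\<And>t. t \<in> U \<Longrightarrow> has_op_deriv (\<lambda>s. L t s)
           (commutator (- neg_part (M t * L t 0 ^ k) + X t) (L t 0))"
    and flow_q: "\<And>t. t \<in> U \<Longrightarrow> has_fun_deriv (\<lambda>s. q t s)
           (act (pos_part (M t * L t 0 ^ k)) (q t 0)
            + (\<lambda>n. of_nat k / 2 * Q t (k - 1) n) + Xact k (Q t) (H t))"
    and flow_r: "\<And>t. t \<in> U \<Longrightarrow> has_fun_deriv (\<lambda>s. r t s)
           (- adj_act (pos_part (M t * L t 0 ^ k)) (r t 0)
            + (\<lambda>n. of_nat k / 2 * R t (k - 1) n) - Xadj_act k (R t) (H t))"
    and t: "t \<in> U"
  shows "neg_part (Lt t 0) = fop (qt t) * Dpow (-1) * fop (rt t) \<and>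
         (\<forall>j\<ge>1. has_op_deriv (\<lambda>x. Lt (t + Poly_Mapping.single j x) 0)
                   (commutator (pos_part (Lt t 0 ^ j)) (Lt t 0))) \<and>
         (\<exists>D. has_op_deriv (\<lambda>x. Lt (t + Poly_Mapping.single (k - 1) x) 0) D \<and>
              has_op_deriv (\<lambda>s. Lt t s)
                (commutator (- neg_part (Mt t * Lt t 0 ^ k) + Xt t) (Lt t 0) - D))"
proof -
  let ?T = "T_I (r t 0)" and ?u = "shift (-1) (recip (r t 0))"
  let ?\<tau> = "adj_inv_act (T_I (r t 0))"
  let ?Lt = "Lt t 0"
  have Lax: "L t' 0 = lax (q t' 0) (r t' 0)" if "t' \<in> U" for t'
    using hierarchy that by (simp add: cdKP_def)
  have r0: "\<forall>n. r t' 0 n \<noteq> 0" if "t' \<in> U" for t'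
    using r_nonzero[OF that] by (rule eventually_nhds_x_imp_x)
  note nz = r0[OF t]
  have act: "formal_action (lax (q t 0) (r t 0)) (q t 0) (r t 0) (Q t) (R t) (H t)"
    using action[OF t] by (simp add: Lax[OF t])
  have Qt0: "Qt t 0 = ?u"
    using action_t[OF t] by (simp add: formal_action_def qt)
  have QtS: "Qt t (Suc i) = ?u * H t i 0" for i
    using const_Q[OF t] by (simp add: T_I_act_def)
  have Rt: "Rt t j = ?\<tau> (R t (Suc j))" for j
    using const_R[OF t] by (simp add: T)
  have Lt0: "Lt t s = gauge (T_I (r t s)) (L t s)" for s
    by (simp add: Lt T)
  \<comment> \<open>What the motion of \<open>r\<close> adds to the generator is, up to sign, the
    correction term in \<open>neg_part_gauge\<close>, so the two summands combine.\<close>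
  have pos: "semisep ?u (?\<tau> (- adj_act (pos_part A) (r t 0))) + gauge ?T (- neg_part A) = - neg_part (gauge ?T A)" for A
    by (simp add: neg_part_gauge[OF nz] adj_inv_act_T_I_linear[OF nz] semisep_uminus_right gauge_T_I_uminus[OF nz])

  have neg: "neg_part ?Lt = fop (qt t) * Dpow (-1) * fop (rt t)"
    using neg_part_gauge_lax[OF nz act Qt0 QtS]
    by (simp add: Lt0 Lax[OF t] qt rt T semisep_def)

  have times: "has_op_deriv (\<lambda>x. Lt (t + Poly_Mapping.single j x) 0) (commutator (pos_part (?Lt ^ j)) ?Lt)"
    if j: "j \<ge> 1" for j
  proof -
    let ?t = "\<lambda>x. t + Poly_Mapping.single j x"
    let ?B = "pos_part (L t 0 ^ j)"
    have t0: "?t 0 = t" by simp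
    have "has_op_deriv (\<lambda>x. L (?t x) 0) (commutator ?B (L (?t 0) 0))"
      "has_fun_deriv (\<lambda>x. r (?t x) 0) (- adj_act ?B (r t 0))"
      unfolding t0 using hierarchy t j unfolding cdKP_def by blast+
    moreover have "\<forall>\<^sub>F x in nhds 0. ?t x \<in> U"
      using hierarchy t j by (simp add: cdKP_def times_open_def)
    then have "\<forall>\<^sub>F x in nhds 0. \<forall>n. r (?t x) 0 n \<noteq> 0"
      by eventually_elim (simp add: r0)
    ultimately have "has_op_deriv (\<lambda>x. gauge (T_I (r (?t x) 0)) (L (?t x) 0))
      (commutator (semisep ?u (?\<tau> (- adj_act ?B (r t 0))) + gauge ?T ?B) ?Lt)"
      using has_op_deriv_gauge[of "\<lambda>x. L (?t x) 0" ?B "\<lambda>x. r (?t x) 0"] by (simp add: Lt0)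
    moreover have "semisep ?u (?\<tau> (- adj_act ?B (r t 0))) + gauge ?T ?B = pos_part (?Lt ^ j)"
    proof -
      \<comment> \<open>Writing \<open>?B\<close> as the full power minus its negative part makes
        \<open>pos\<close> applicable.\<close>
      have "semisep ?u (?\<tau> (- adj_act ?B (r t 0))) + gauge ?T ?B
          = (semisep ?u (?\<tau> (- adj_act ?B (r t 0))) + gauge ?T (- neg_part (L t 0 ^ j))) + gauge ?T (L t 0 ^ j)"
        unfolding add.assoc gauge_T_I_add[OF nz, symmetric] by (simp add: neg_part_def)
      also have "\<dots> = pos_part (?Lt ^ j)"
        unfolding pos by (simp add: gauge_T_I_power[OF nz] Lt0 neg_part_def)
      finally show ?thesis .
    qed
    ultimately show ?thesis by (simp add: Lt T)
  qed

  have add: "has_op_deriv (\<lambda>s. Lt t s)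
      (commutator (- neg_part (Mt t * ?Lt ^ k) + Xt t) ?Lt - commutator (pos_part (?Lt ^ (k - 1))) ?Lt)"
  proof -
    let ?A = "M t * L t 0 ^ k"
    let ?g = "(\<lambda>n. of_nat k / 2 * R t (k - 1) n) - Xadj_act k (R t) (H t)"
    have "has_fun_deriv (\<lambda>s. r t s) (- adj_act (pos_part ?A) (r t 0) + ?g)"
      using flow_r[OF t] by (simp only: add_diff_eq)
    then have "has_op_deriv (\<lambda>s. Lt t s)
      (commutator (semisep ?u (?\<tau> (- adj_act (pos_part ?A) (r t 0) + ?g)) + gauge ?T (- neg_part ?A + X t)) ?Lt)"
      unfolding Lt0 by (rule has_op_deriv_gauge[OF flow_L[OF t] _ r_nonzero[OF t]])
    \<comment> \<open>The generator splits into the Orlov-Schulman part, handled by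
      \<open>pos\<close>, and the part of \<open>X\<close>, handled by
      \<open>gauge_Xop\<close>.\<close>
    also have "semisep ?u (?\<tau> (- adj_act (pos_part ?A) (r t 0) + ?g)) + gauge ?T (- neg_part ?A + X t)
      = (semisep ?u (?\<tau> (- adj_act (pos_part ?A) (r t 0))) + gauge ?T (- neg_part ?A))
        + (gauge ?T (X t) + semisep ?u (?\<tau> ?g))"
      by (simp only: adj_inv_act_T_I_linear(1)[OF nz] semisep_add_right gauge_T_I_add[OF nz] add_ac)
    also have "\<dots> = - neg_part (gauge ?T ?A) + (Xt t + neg_part (?Lt ^ (k - 1)))"
      unfolding pos X Xt Lt0 Lax[OF t] gauge_Xop[OF nz act Qt0 QtS Rt k] by (rule refl)
    also have "gauge ?T ?A = Mt t * ?Lt ^ k"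
      by (simp add: gauge_T_I_times[OF nz] gauge_T_I_power[OF nz] Mt T Lt0)
    \<comment> \<open>A power commutes with its base, so the excess negative part generates minus
      the flow of the time with index \<open>k - 1\<close>.\<close>
    also have "commutator (- neg_part (Mt t * ?Lt ^ k) + (Xt t + neg_part (?Lt ^ (k - 1)))) ?Lt =
        commutator (- neg_part (Mt t * ?Lt ^ k) + Xt t) ?Lt - commutator (pos_part (?Lt ^ (k - 1))) ?Lt"
      unfolding commutator_pos_part_power by (simp add: commutator_def algebra_simps)
    finally show ?thesis .
  qed
  show ?thesis
  proof (intro conjI exI allI impI)
    \<comment> \<open>The witness for the time derivative is the Lax commutator;
      \<open>k \<ge> 2\<close> makes \<open>k - 1\<close> an admissible time index.\<close>
    show "has_op_deriv (\<lambda>x. Lt (t + Poly_Mapping.single (k - 1) x) 0) (commutator (pos_part (?Lt ^ (k - 1))) ?Lt)"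
      using k by (intro times) simp
  qed (use neg times add in simp_all)
qed

end
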